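(* Let $z:[0,\infty)\to[0,\infty]$ be nonincreasing and lower semi-continuous, set $c(\phi)=z(\phi)\phi$ (with $c(0)=0$), and let $\tau=\tau^z$, where $\tau^z(w)=\inf\{F^c[\psi]\mid\psi:\mathbb{R}\to[0,\infty),\ \int_{\mathbb{R}}\psi\,dy=w\}$. Let $g=(z^{-1}(\cdot))^{3/2}$ and $r(s)=\frac{2\sqrt2}{3\sqrt{-s}}$ for $s<0$, $r(s)=0$ otherwise. Then $$[-\tau(-\cdot)]^\ast(t)=[g*r](t)$$ holds for all $t\in\{\tau'(w)\mid w\geq0,\ \tau\text{ is differentiable at }w\}$.
   Context: For $c:[0,\infty)\to[0,\infty)$ and $\psi:\mathbb{R}\to\mathbb{R}$ (with locally integrable weak derivative; otherwise the energy is $+\infty$), $F^c[\psi]=\int_{\mathbb{R}}\frac12|\psi'(y)|^2+c(|\psi(y)|)\,dy$. The generalized inverse of a nonincreasing lower semi-continuous $f:[0,\infty)\to[0,\infty]$ is $f^{-1}(x)=\inf\{y\in[0,\infty)\mid f(y)\leq x\}$ with $\inf\emptyset=\infty$. $[-\tau(-\cdot)]^\ast$ is the Legendre–Fenchel conjugate of $s\mapsto-\tau(-s)$, where $\tau$ is extended by $-\infty$ on $(-\infty,0)$; explicitly $[-\tau(-\cdot)]^\ast(t)=\sup_{w\geq0}(\tau(w)-tw)$. Convolution: $[g*r](t)=\int_{\mathbb{R}}g(s)r(t-s)\,ds=\int_t^\infty\frac{2\sqrt2\,g(s)}{3\sqrt{s-t}}\,ds$. At $w=0$, $\tau'(0)$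 denotes the right derivative. *)

theory Defs
  imports "HOL-Analysis.Analysis"
begin

(* z : [0,oo) -> [0,oo], represented as real => ennreal; only values on {0..} matter *)

definition nonincr_on_nonneg :: "(real \<Rightarrow> ennreal) \<Rightarrow> bool" where
  "nonincr_on_nonneg z \<longleftrightarrow> (\<forall>x y. 0 \<le> x \<longrightarrow> x \<le> y \<longrightarrow> z y \<le> z x)"

definition lsc_on_nonneg :: "(real \<Rightarrow> ennreal) \<Rightarrow> bool" where
  "lsc_on_nonneg z \<longleftrightarrow>
     (\<forall>x\<ge>0. \<forall>a. a < z x \<longrightarrow> (\<forall>\<^sub>F y in at x within {0..}. a < z y))"

definition cfun :: "(real \<Rightarrow> ennreal) \<Rightarrow> real \<Rightarrow> ennreal" where
  "cfun z \<phi> = (if \<phi> = 0 then 0 else z \<phi> * ennreal \<phi>)"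

definition test_function :: "(real \<Rightarrow> real) \<Rightarrow> bool" where
  "test_function \<phi> \<longleftrightarrow>
     (\<forall>n x. ((deriv ^^ n) \<phi>) differentiable (at x)) \<and> bounded {x. \<phi> x \<noteq> 0}"

definition weak_deriv :: "(real \<Rightarrow> real) \<Rightarrow> (real \<Rightarrow> real) \<Rightarrow> bool" where
  "weak_deriv \<psi> d\<psi> \<longleftrightarrow>
     (\<forall>a b. set_integrable lborel {a..b} \<psi> \<and> set_integrable lborel {a..b} d\<psi>) \<and>
     (\<forall>\<phi>. test_function \<phi> \<longrightarrow>
        (\<integral>y. \<psi> y * deriv \<phi> y \<partial>lborel) = - (\<integral>y. d\<psi> y * \<phi> y \<partial>lborel))"

(* F^c[psi]; +oo if psi has no locally integrable weak derivative
   (the weak derivative is unique a.e., so the INF is over equal values) *)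
definition energy :: "(real \<Rightarrow> ennreal) \<Rightarrow> (real \<Rightarrow> real) \<Rightarrow> ennreal" where
  "energy c \<psi> =
     (INF d\<psi> \<in> {d\<psi>. weak_deriv \<psi> d\<psi>}.
        \<integral>\<^sup>+ y. ennreal (1/2 * (d\<psi> y)\<^sup>2) + c \<bar>\<psi> y\<bar> \<partial>lborel)"

definition tau :: "(real \<Rightarrow> ennreal) \<Rightarrow> real \<Rightarrow> ennreal" where
  "tau z w = (INF \<psi> \<in> {\<psi>. (\<forall>y. 0 \<le> \<psi> y) \<and> has_bochner_integral lborel \<psi> w}.
                energy (cfun z) \<psi>)"

(* generalized inverse z^{-1}(x) = inf { y >= 0 | z y <= x }, inf {} = oo *)
definition gen_inv :: "(real \<Rightarrow> ennreal) \<Rightarrow> real \<Rightarrow> ennreal" where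
  "gen_inv z x = Inf {ennreal y | y. 0 \<le> y \<and> enn2ereal (z y) \<le> ereal x}"

definition gfun :: "(real \<Rightarrow> ennreal) \<Rightarrow> real \<Rightarrow> ennreal" where
  "gfun z s = (if gen_inv z s = \<infinity> then \<infinity>
               else ennreal (enn2real (gen_inv z s) powr (3/2)))"

definition rfun :: "real \<Rightarrow> real" where
  "rfun s = (if s < 0 then 2 * sqrt 2 / (3 * sqrt (- s)) else 0)"

definition conv_gr :: "(real \<Rightarrow> ennreal) \<Rightarrow> real \<Rightarrow> ennreal" where
  "conv_gr z t = (\<integral>\<^sup>+ s. gfun z s * ennreal (rfun (t - s)) \<partial>lborel)"

(* [-tau(-.)]^*(t) = sup_{w >= 0} (tau(w) - t w) *)
definition conj_tau :: "(real \<Rightarrow> ennreal) \<Rightarrow> real \<Rightarrow> ereal" where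
  "conj_tau z t = (SUP w \<in> {0..}. enn2ereal (tau z w) - ereal (t * w))"

definition tau_deriv_values :: "(real \<Rightarrow> ennreal) \<Rightarrow> real set" where
  "tau_deriv_values z = {t. \<exists>w\<ge>0. tau z w \<noteq> \<infinity> \<and>
       (\<forall>\<^sub>F v in at w within {0..}. tau z v \<noteq> \<infinity>) \<and>
       ((\<lambda>v. enn2real (tau z v)) has_real_derivative t) (at w within {0..})}"

end

theory Submission
  imports Defs
begin

text \<open>
  Let \<open>G s = 2 \<integral> sqrt (2 x (z x - s)\<^sub>+) dx\<close>. By Tonelli this is \<open>g * r\<close> at \<open>s\<close>, because \<open>g s\<close> is the
  integral of \<open>3/2 sqrt x\<close> over \<open>{x. s < z x}\<close>.

  A profile solving \<open>\<psi>' = sqrt (2 \<psi> (z \<psi> - s)\<^sub>+)\<close> (regularised so that it reaches every mass),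
  reflected at its maximum, shows \<open>\<tau> w \<le> G s + s w\<close> for all \<open>s \<ge> 0\<close>. Conversely, for an admissible
  \<open>\<psi>\<close> let \<open>s\<close> be the infimum of \<open>z \<psi>\<close>. Then \<open>z \<psi> - s \<ge> 0\<close>, so AM-GM bounds the energy minus \<open>s w\<close> from
  below by the integral of \<open>\<bar>\<psi>'\<bar> sqrt (2 \<psi> (z \<psi> - s))\<close>, and since \<open>\<psi>\<close> crosses every level below its
  supremum at least twice, this is at least \<open>G s\<close>. Hence \<open>\<tau> w\<close> is the infimum of \<open>G s + s w\<close> over
  \<open>s \<ge> 0\<close>.

  If \<open>\<tau>\<close> is differentiable at \<open>w\<close> with derivative \<open>t\<close>, near-optimal values of \<open>s\<close> for masses slightly
  larger than \<open>w\<close> are slopes of lines almost touching \<open>\<tau>\<close> from above, so they converge to \<open>t\<close>; lower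
  semicontinuity of \<open>G\<close> (Fatou) gives \<open>G t \<le> \<tau> w - t w\<close>.
\<close>

text \<open>The \<open>s\<close> of the lower bound is constrained from two sides: AM-GM needs
  \<open>s\<close> below \<open>z\<close> along the whole profile, and the crossing count needs
  every height \<open>x\<close> with \<open>s < z x\<close> to be reached. The infimum of
  \<open>z\<close> along the profile meets both, so \<open>s\<close> depends on the profile. For the
  upper bound the profile equation degenerates at heights with \<open>z x \<le> s\<close>: the slope
  vanishes and the profile cannot rise further. Adding \<open>\<eta>\<^sup>2\<close> under the root
  keeps the slope at least \<open>\<eta>\<close>, while the height needed for mass \<open>w\<close>
  stays bounded independently of \<open>\<eta>\<close>, so the extra cost tends to 0. The energy
  uses weak derivatives of functions known only up to null sets, whereas crossings need continuity;
  hence the du Bois-Reymond lemma. Slopes are merely Borel functions of height, so the change of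
  variables is an identity of measures. The conjugate is convex in \<open>t\<close>, but
  \<open>G\<close> need not be: for \<open>z\<close> equal to 1 on [0,1) and 0 beyond,
  \<open>G\<close> is a multiple of \<open>sqrt (1 - s)\<close> on [0,1]. Equality needs a slope
  whose line \<open>G t + t w\<close> touches \<tau>, and differentiability supplies it.\<close>

section \<open>The convolution as an integral over heights\<close>

text \<open>The factor 2 counts the rising and the falling flank of a profile; the root is the slope
  that gives equality in AM-GM. The infinite case is separate because
  \<open>enn2real \<infinity>\<close> is 0.\<close>

definition optimal_density :: "(real \<Rightarrow> ennreal) \<Rightarrow> real \<Rightarrow> real \<Rightarrow> ennreal" where
  "optimal_density z s x =
     (if x \<le> 0 then 0 else if z x = \<infinity> then \<infinity>
      else ennreal (2 * sqrt (2 * x * max 0 (enn2real (z x) - s))))"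

lemma ennreal_eq_top_if_of_nat_le:
  assumes "\<And>n. of_nat n \<le> (x::ennreal)"
  shows "x = \<infinity>"
proof (rule ccontr)
  assume "x \<noteq> \<infinity>"
  then obtain n where "x < of_nat n" using ennreal_Ex_less_of_nat[of x] by (auto simp: less_top)
  then show False using assms[of n] by simp
qed

text \<open>Endpoints enter only through one-sided limits of \<open>F\<close>, because the integrand
  \<open>1 / sqrt (s - t)\<close> needed below is unbounded at its left end.\<close>

lemma nn_integral_FTC_Ioo:
  fixes F f :: "real \<Rightarrow> real"
  assumes "a < b"
    and F: "\<And>x. a < x \<Longrightarrow> x < b \<Longrightarrow> (F has_real_derivative f x) (at x)"
    and f: "\<And>x. a < x \<Longrightarrow> x < b \<Longrightarrow> isCont f x" "\<And>x. a < x \<Longrightarrow> x < b \<Longrightarrow> 0 \<le> f x"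
    and lim: "(F \<longlongrightarrow> F a) (at_right a)" "(F \<longlongrightarrow> F b) (at_left b)"
  shows "(\<integral>\<^sup>+ x. indicator {a<..<b} x * ennreal (f x) \<partial>lborel) = ennreal (F b - F a)"
proof -
  have ab: "ereal a < ereal b" using assms by simp
  have "((F \<circ> real_of_ereal) \<longlongrightarrow> F a) (at_right (ereal a))" "((F \<circ> real_of_ereal) \<longlongrightarrow> F b) (at_left (ereal b))"
    using lim by (auto simp: ereal_tendsto_simps)
  note * = interval_integral_FTC_nonneg[OF ab _ _ _ this, of f]
  have i: "set_integrable lborel (einterval a b) f" and v: "(LBINT x=ereal a..ereal b. f x) = F b - F a"
    by (rule *; use F f in \<open>auto\<close>)+
  have e: "einterval a b = {a<..<b}" by (auto simp: einterval_def)
  have "(\<integral>\<^sup>+ x. indicator {a<..<b} x * ennreal (f x) \<partial>lborel) = (\<integral>\<^sup>+ x. ennreal (indicator {a<..<b} x * f x) \<partial>lborel)"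
    by (intro nn_integral_cong) (auto simp: indicator_def)
  also have "\<dots> = ennreal (\<integral>x. indicator {a<..<b} x * f x \<partial>lborel)"
    using i e f by (intro nn_integral_eq_integral) (auto simp: set_integrable_def indicator_def intro!: AE_I2)
  also have "(\<integral>x. indicator {a<..<b} x * f x \<partial>lborel) = F b - F a"
    using v ab by (simp add: interval_lebesgue_integral_def set_lebesgue_integral_def e)
  finally show ?thesis .
qed

text \<open>Superlevel sets of a monotone function are intervals. The argument is clipped to
  \<open>max 0 x\<close> because \<open>z\<close> is constrained only on the nonnegative
  half-line.\<close>

lemma borel_measurable_nonincr:
  assumes "nonincr_on_nonneg z"
  shows "(\<lambda>x. z (max 0 x)) \<in> borel_measurable borel"
proof (rule borel_measurableI_greater)
  fix a
  have "is_interval {x. a < z (max 0 x)}"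
    unfolding is_interval_1
  proof (intro ballI allI impI)
    fix x y w assume "x \<in> {x. a < z (max 0 x)}" "y \<in> {x. a < z (max 0 x)}" "x \<le> w \<and> w \<le> y"
    then show "w \<in> {x. a < z (max 0 x)}"
      using assms[unfolded nonincr_on_nonneg_def, rule_format, of "max 0 w" "max 0 y"]
      by (auto intro: order.strict_trans2)
  qed
  from real_interval_borel_measurable[OF this] show "{x \<in> space borel. a < z (max 0 x)} \<in> sets borel" by simp
qed

lemma lsc_right_nbhd:
  assumes "lsc_on_nonneg z" "0 \<le> x" "a < z x"
  obtains \<delta> where "\<delta> > 0" "\<And>y. x \<le> y \<Longrightarrow> y < x + \<delta> \<Longrightarrow> a < z y"
proof -
  have "\<forall>\<^sub>F y in at x within {0..}. a < z y" using assms unfolding lsc_on_nonneg_def by blast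
  then obtain d where "d > 0" "\<And>y. y \<ge> 0 \<Longrightarrow> y \<noteq> x \<Longrightarrow> dist y x < d \<Longrightarrow> a < z y"
    unfolding eventually_at by auto
  note d = this
  show ?thesis
  proof (rule that[OF d(1)])
    fix y assume "x \<le> y" "y < x + d"
    then show "a < z y" using d(2)[of y] assms(2,3) by (cases "y = x") (auto simp: dist_real_def)
  qed
qed

text \<open>By monotonicity the set whose infimum is \<open>gen_inv z s\<close> is an up-set, and
  lower semicontinuity makes it closed, so lying strictly below the infimum is the same as lying
  outside the set.\<close>

lemma less_gen_inv_iff:
  assumes z: "nonincr_on_nonneg z" "lsc_on_nonneg z" and "0 \<le> x"
  shows "ennreal x < gen_inv z s \<longleftrightarrow> ereal s < enn2ereal (z x)"
proof
  assume "ennreal x < gen_inv z s"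
  then show "ereal s < enn2ereal (z x)"
    using Inf_lower[of "ennreal x" "{ennreal y |y. 0 \<le> y \<and> enn2ereal (z y) \<le> ereal s}"] \<open>0 \<le> x\<close>
    unfolding gen_inv_def by (force simp: not_le[symmetric])
next
  assume s: "ereal s < enn2ereal (z x)"
  have "\<exists>\<delta>>0. \<forall>y\<ge>x. y < x + \<delta> \<longrightarrow> ereal s < enn2ereal (z y)"
  proof (cases "s \<ge> 0")
    case True
    have *: "ereal s < enn2ereal u \<longleftrightarrow> ennreal s < u" for u
      using True by (simp add: less_ennreal.rep_eq)
    show ?thesis using lsc_right_nbhd[OF z(2) \<open>0 \<le> x\<close>, of "ennreal s"] s unfolding * by metis
  next
    \<comment> \<open>For negative \<open>s\<close> every value of \<open>z\<close> exceeds
      \<open>s\<close>. The comparison is made in \<open>ereal\<close> because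
      \<open>ennreal s\<close> would truncate to 0.\<close>
    case False
    then have "ereal s < enn2ereal u" for u
      by (intro order.strict_trans2[OF _ enn2ereal_nonneg]) simp
    then show ?thesis using zero_less_one by blast
  qed
  then obtain d where d: "d > 0" "\<And>y. y \<ge> x \<Longrightarrow> y < x + d \<Longrightarrow> ereal s < enn2ereal (z y)" by blast
  have "ennreal (x + d) \<le> gen_inv z s"
    unfolding gen_inv_def
  proof (rule Inf_greatest, clarify)
    fix y assume y: "0 \<le> y" "enn2ereal (z y) \<le> ereal s"
    show "ennreal (x + d) \<le> ennreal y"
    proof (rule ccontr)
      assume "\<not> ?thesis"
      then have "y < x + d" using not_le ennreal_leI by blast
      \<comment> \<open>The point \<open>max x y\<close> lies in the window
        \<open>[x, x + d)\<close> and is at least \<open>y\<close>, so one use of monotonicity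
        covers both orders of \<open>x\<close> and \<open>y\<close>.\<close>
      then have "z (max x y) \<le> z y" "ereal s < enn2ereal (z (max x y))"
        using z(1) y d(1) \<open>0 \<le> x\<close> unfolding nonincr_on_nonneg_def by (auto intro!: d(2))
      then show False using y(2) by (meson less_eq_ennreal.rep_eq not_le order.trans)
    qed
  qed
  moreover have "ennreal x < ennreal (x + d)" using d \<open>0 \<le> x\<close> by (simp add: ennreal_less_iff)
  ultimately show "ennreal x < gen_inv z s" by simp
qed

lemma nn_integral_sqrt:
  assumes "0 \<le> m"
  shows "(\<integral>\<^sup>+ x. indicator {0<..<m} x * ennreal (3/2 * sqrt x) \<partial>lborel) = ennreal (m powr (3/2))"
proof (cases "m = 0")
  case False
  with assms have "m > 0" by simp
  have "(\<integral>\<^sup>+ x. indicator {0<..<m} x * ennreal (3/2 * sqrt x) \<partial>lborel) = ennreal (m powr (3/2) - 0 powr (3/2))"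
  proof (rule nn_integral_FTC_Ioo[where F = "\<lambda>x. x powr (3/2)"])
    fix x :: real assume "0 < x" "x < m"
    then show "((\<lambda>x. x powr (3/2)) has_real_derivative 3/2 * sqrt x) (at x)"
      by (auto intro!: derivative_eq_intros simp: powr_half_sqrt)
    show "isCont (\<lambda>x. 3/2 * sqrt x) x" by (intro continuous_intros)
  next
    show "((\<lambda>x::real. x powr (3/2)) \<longlongrightarrow> 0 powr (3/2)) (at_right 0)"
      by (rule tendsto_powr') (auto intro!: tendsto_eq_intros simp: eventually_at_right_less eventually_at_filter)
    show "((\<lambda>x. x powr (3/2)) \<longlongrightarrow> m powr (3/2)) (at_left m)"
      using \<open>m > 0\<close> by (auto intro!: tendsto_eq_intros)
  qed (use \<open>m > 0\<close> in auto)
  then show ?thesis by simp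
qed (simp add: greaterThanLessThan_empty)

lemma nn_integral_inverse_sqrt:
  assumes "t \<le> u"
  shows "(\<integral>\<^sup>+ s. indicator {t<..<u} s * ennreal (1 / sqrt (s - t)) \<partial>lborel) = ennreal (2 * sqrt (u - t))"
proof (cases "t = u")
  case False
  with assms have "t < u" by simp
  have "(\<integral>\<^sup>+ s. indicator {t<..<u} s * ennreal (1 / sqrt (s - t)) \<partial>lborel) = ennreal (2 * sqrt (u - t) - 2 * sqrt (t - t))"
  proof (rule nn_integral_FTC_Ioo[where F = "\<lambda>s. 2 * sqrt (s - t)"])
    fix x :: real assume "t < x" "x < u"
    then show "((\<lambda>s. 2 * sqrt (s - t)) has_real_derivative 1 / sqrt (x - t)) (at x)"
      by (auto intro!: derivative_eq_intros simp: field_simps)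
    show "isCont (\<lambda>s. 1 / sqrt (s - t)) x" using \<open>t < x\<close> by (intro continuous_intros) auto
  qed (use \<open>t < u\<close> in \<open>auto intro!: tendsto_eq_intros\<close>)
  then show ?thesis by simp
qed simp

text \<open>Layer cake: \<open>3/2 * sqrt x\<close> is the derivative of
  \<open>x powr (3/2)\<close>, and \<open>less_gen_inv_iff\<close> identifies the heights below
  \<open>gen_inv z s\<close>. When the inverse is infinite, the truncations to \<open>(0, n)\<close>
  already contribute \<open>n powr (3/2)\<close>, which is at least \<open>n\<close>.\<close>

lemma gfun_eq_nn_integral:
  assumes z: "nonincr_on_nonneg z" "lsc_on_nonneg z"
  shows "gfun z s = (\<integral>\<^sup>+ x. indicator {x. 0 < x \<and> ereal s < enn2ereal (z x)} x * ennreal (3/2 * sqrt x) \<partial>lborel)"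
proof -
  have e: "indicator {x. 0 < x \<and> ereal s < enn2ereal (z x)} x = (indicator {x. 0 < x \<and> ennreal x < gen_inv z s} x :: ennreal)" for x
    using less_gen_inv_iff[OF z, of x s] by (auto simp: indicator_def)
  show ?thesis unfolding e
  proof (cases "gen_inv z s")
    case (real m)
    then have "indicator {x. 0 < x \<and> ennreal x < gen_inv z s} x = (indicator {0<..<m} x :: ennreal)" for x
      by (auto simp: indicator_def ennreal_less_iff)
    then show "gfun z s = (\<integral>\<^sup>+ x. indicator {x. 0 < x \<and> ennreal x < gen_inv z s} x * ennreal (3/2 * sqrt x) \<partial>lborel)"
      using real nn_integral_sqrt[of m] by (simp add: gfun_def)
  next
    case top
    have "ennreal (of_nat n powr (3/2)) \<le> (\<integral>\<^sup>+ x. indicator {x. 0 < x \<and> ennreal x < gen_inv z s} x * ennreal (3/2 * sqrt x) \<partial>lborel)" for n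
      unfolding nn_integral_sqrt[symmetric, OF of_nat_0_le_iff] using top
      by (intro nn_integral_mono) (auto simp: indicator_def)
    moreover have "of_nat n \<le> ennreal (of_nat n powr (3/2))" for n
    proof -
      have "real n \<le> real n powr (3/2)" 
        by (cases "n = 0") (auto intro: order_trans[OF _ powr_mono[of 1]])
      then show ?thesis by (metis ennreal_leI ennreal_of_nat_eq_real_of_nat)
    qed
    ultimately have "of_nat n \<le> (\<integral>\<^sup>+ x. indicator {x. 0 < x \<and> ennreal x < gen_inv z s} x * ennreal (3/2 * sqrt x) \<partial>lborel)" for n
      using order_trans by blast
    then have "(\<integral>\<^sup>+ x. indicator {x. 0 < x \<and> ennreal x < gen_inv z s} x * ennreal (3/2 * sqrt x) \<partial>lborel) = \<infinity>"
      by (rule ennreal_eq_top_if_of_nat_le)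
    then show "gfun z s = (\<integral>\<^sup>+ x. indicator {x. 0 < x \<and> ennreal x < gen_inv z s} x * ennreal (3/2 * sqrt x) \<partial>lborel)"
      using top by (simp add: gfun_def)
  qed
qed

text \<open>The constants combine: 3/2 times the \<open>2 * sqrt 2 / 3\<close> of
  \<open>rfun\<close> is \<open>sqrt 2\<close>, and integrating \<open>1 / sqrt (s - t)\<close> up
  to \<open>z x\<close> gives \<open>2 * sqrt (z x - t)\<close>.\<close>

lemma optimal_density_eq_nn_integral:
  assumes "0 < x"
  shows "optimal_density z t x = (\<integral>\<^sup>+ s. ennreal (3/2 * sqrt x) * (indicator {s. ereal s < enn2ereal (z x)} s * ennreal (rfun (t - s))) \<partial>lborel)"
    (is "_ = ?I")
proof -
  have e: "ennreal (3/2 * sqrt x) * (indicator {s. ereal s < enn2ereal (z x)} s * ennreal (rfun (t - s))) =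
     ennreal (sqrt 2 * sqrt x) * (indicator {s. t < s \<and> ereal s < enn2ereal (z x)} s * ennreal (1 / sqrt (s - t)))" for s
    using assms by (auto simp: indicator_def rfun_def ennreal_mult[symmetric] intro!: arg_cong[of _ _ ennreal])
  have I: "?I = ennreal (sqrt 2 * sqrt x) * (\<integral>\<^sup>+ s. indicator {s. t < s \<and> ereal s < enn2ereal (z x)} s * ennreal (1 / sqrt (s - t)) \<partial>lborel)"
    unfolding e by (rule nn_integral_cmult) measurable
  show ?thesis
  proof (cases "z x")
    case (real u)
    have "indicator {s. t < s \<and> ereal s < enn2ereal (z x)} s = (indicator {t<..<max t u} s :: ennreal)" for s
      using real by (auto simp: indicator_def)
    then show ?thesis unfolding I using assms real
      by (simp add: nn_integral_inverse_sqrt optimal_density_def ennreal_mult[symmetric] real_sqrt_mult max_def mult_ac)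
  next
    case top
    \<comment> \<open>Stopping the integration at \<open>t + n^2\<close> gives \<open>2 * n\<close>,
      so the full integral exceeds every natural number.\<close>
    have "ennreal (2 * sqrt ((t + real n ^ 2) - t)) \<le> (\<integral>\<^sup>+ s. indicator {s. t < s \<and> ereal s < enn2ereal (z x)} s * ennreal (1 / sqrt (s - t)) \<partial>lborel)" for n
      by (subst nn_integral_inverse_sqrt[symmetric]) (use top in \<open>auto intro!: nn_integral_mono simp: indicator_def\<close>)
    moreover have "of_nat n \<le> ennreal (2 * sqrt ((t + real n ^ 2) - t))" for n
      by (simp add: ennreal_of_nat_eq_real_of_nat)
    ultimately have "of_nat n \<le> (\<integral>\<^sup>+ s. indicator {s. t < s \<and> ereal s < enn2ereal (z x)} s * ennreal (1 / sqrt (s - t)) \<partial>lborel)" for n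
      using order_trans by blast
    then have "(\<integral>\<^sup>+ s. indicator {s. t < s \<and> ereal s < enn2ereal (z x)} s * ennreal (1 / sqrt (s - t)) \<partial>lborel) = \<infinity>"
      by (rule ennreal_eq_top_if_of_nat_le)
    then show ?thesis unfolding I using assms top
      by (simp add: optimal_density_def ennreal_mult_top)
  qed
qed

lemma measurable_optimal_density [measurable]:
  assumes "nonincr_on_nonneg z"
  shows "optimal_density z s \<in> borel_measurable borel"
proof -
  note [measurable] = borel_measurable_nonincr[OF assms]
  have "optimal_density z s = (\<lambda>x. if x \<le> 0 then 0 else if z (max 0 x) = \<infinity> then \<infinity>
      else ennreal (2 * sqrt (2 * x * max 0 (enn2real (z (max 0 x)) - s))))"
    by (auto simp: optimal_density_def fun_eq_iff max_def)
  also have "\<dots> \<in> borel_measurable borel" by measurable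
  finally show ?thesis .
qed

lemma conv_gr_eq_nn_integral:
  assumes z: "nonincr_on_nonneg z" "lsc_on_nonneg z"
  shows "conv_gr z t = (\<integral>\<^sup>+ x. optimal_density z t x \<partial>lborel)"
proof -
  note [measurable] = borel_measurable_nonincr[OF z(1)]
  have [measurable]: "rfun \<in> borel_measurable borel" unfolding rfun_def by measurable
  \<comment> \<open>The clipped argument makes \<open>A\<close> jointly Borel; the condition
    \<open>0 < x\<close> removes the points where clipping changes anything.\<close>
  define A where "A = {(s, x). 0 < x \<and> ereal s < enn2ereal (z (max 0 x))}"
  have [measurable]: "A \<in> sets (borel \<Otimes>\<^sub>M borel)"
  proof -
    have "{w \<in> space (borel \<Otimes>\<^sub>M borel). 0 < snd w \<and> ereal (fst w) < enn2ereal (z (max 0 (snd w)))} \<in> sets (borel \<Otimes>\<^sub>M (borel::real measure))"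
      by measurable
    also have "{w \<in> space (borel \<Otimes>\<^sub>M borel). 0 < snd w \<and> ereal (fst w) < enn2ereal (z (max 0 (snd w)))} = A"
      by (auto simp: A_def space_pair_measure)
    finally show ?thesis .
  qed
  let ?f = "\<lambda>s x. indicator A (s, x) * ennreal (3/2 * sqrt x) * ennreal (rfun (t - s))"
  have "conv_gr z t = (\<integral>\<^sup>+ s. (\<integral>\<^sup>+ x. ?f s x \<partial>lborel) \<partial>lborel)"
    unfolding conv_gr_def gfun_eq_nn_integral[OF z]
  proof (rule nn_integral_cong)
    fix s :: real
    have m: "(\<lambda>x. indicator A (s, x) * ennreal (3/2 * sqrt x)) \<in> borel_measurable lborel" by measurable
    have "(\<integral>\<^sup>+ x. indicator {x. 0 < x \<and> ereal s < enn2ereal (z x)} x * ennreal (3/2 * sqrt x) \<partial>lborel) =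
       (\<integral>\<^sup>+ x. indicator A (s, x) * ennreal (3/2 * sqrt x) \<partial>lborel)"
      by (intro nn_integral_cong) (auto simp: A_def indicator_def max_def)
    then show "(\<integral>\<^sup>+ x. indicator {x. 0 < x \<and> ereal s < enn2ereal (z x)} x * ennreal (3/2 * sqrt x) \<partial>lborel) * ennreal (rfun (t - s)) =
      (\<integral>\<^sup>+ x. ?f s x \<partial>lborel)"
      by (simp only: nn_integral_multc[OF m])
  qed
  also have "\<dots> = (\<integral>\<^sup>+ x. (\<integral>\<^sup>+ s. ?f s x \<partial>lborel) \<partial>lborel)"
    by (rule lborel_pair.Fubini') measurable
  also have "\<dots> = (\<integral>\<^sup>+ x. optimal_density z t x \<partial>lborel)"
  proof (rule nn_integral_cong)
    fix x :: real
    show "(\<integral>\<^sup>+ s. ?f s x \<partial>lborel) = optimal_density z t x"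
    proof (cases "0 < x")
      case True
      show ?thesis unfolding optimal_density_eq_nn_integral[OF True]
        using True by (intro nn_integral_cong) (auto simp: A_def indicator_def max_def)
    qed (simp add: A_def optimal_density_def)
  qed
  finally show ?thesis .
qed

section \<open>The du Bois-Reymond lemma\<close>

text \<open>For \<open>i = 0\<close> this is the classical smooth function that is flat at 0. The
  extra powers of \<open>1 / x\<close> close the family under differentiation up to linear
  combinations.\<close>

definition exp_cutoff :: "real \<Rightarrow> nat \<Rightarrow> real \<Rightarrow> real" where
  "exp_cutoff \<kappa> i x = (if x > 0 then exp (- (\<kappa> / x)) / x ^ i else 0)"

text \<open>With \<open>y = \<kappa> / x\<close> tending to infinity this is the decay of
  \<open>y ^ Suc i / exp y\<close>, up to a constant factor.\<close>

lemma exp_cutoff_div_tendsto_0: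
  assumes "\<kappa> > 0"
  shows "((\<lambda>x. exp_cutoff \<kappa> i x / x) \<longlongrightarrow> 0) (at_right 0)"
proof -
  have lim: "filterlim (\<lambda>x. \<kappa> / x) at_top (at_right 0)"
    using filterlim_tendsto_pos_mult_at_top[OF tendsto_const assms filterlim_inverse_at_top_right]
    by (simp add: divide_inverse)
  have "((\<lambda>x. (\<kappa> / x) ^ Suc i / exp (\<kappa> / x)) \<longlongrightarrow> 0) (at_right 0)"
    by (rule filterlim_compose[OF tendsto_power_div_exp_0 lim])
  then have "((\<lambda>x. (\<kappa> / x) ^ Suc i / exp (\<kappa> / x) / \<kappa> ^ Suc i) \<longlongrightarrow> 0 / \<kappa> ^ Suc i) (at_right 0)"
    using assms by (intro tendsto_divide tendsto_const) auto
  moreover have "\<forall>\<^sub>F x in at_right 0. (\<kappa> / x) ^ Suc i / exp (\<kappa> / x) / \<kappa> ^ Suc i = exp_cutoff \<kappa> i x / x"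
    using assms by (intro eventually_mono[OF eventually_at_right_less[of 0]]) (simp add: exp_cutoff_def exp_minus field_simps)
  ultimately show ?thesis using filterlim_cong[OF refl refl] by fastforce
qed

text \<open>Only 0 is delicate: there the difference quotient is
  \<open>exp_cutoff \<kappa> i x / x\<close> itself, which vanishes on the left and tends to 0 on
  the right, matching the value 0 of the formula.\<close>

lemma has_derivative_exp_cutoff:
  assumes "\<kappa> > 0"
  shows "(exp_cutoff \<kappa> i has_real_derivative \<kappa> * exp_cutoff \<kappa> (i + 2) x - i * exp_cutoff \<kappa> (i + 1) x) (at x)"
proof -
  consider "x > 0" | "x < 0" | "x = 0" by linarith
  then show ?thesis
  proof cases
    case 1
    have "((\<lambda>x. exp (- (\<kappa> / x)) / x ^ i) has_real_derivative \<kappa> * exp_cutoff \<kappa> (i + 2) x - i * exp_cutoff \<kappa> (i + 1) x) (at x)"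
    proof (rule DERIV_cong)
      show "((\<lambda>x. exp (- (\<kappa> / x)) / x ^ i) has_real_derivative
         (exp (- (\<kappa> / x)) * (\<kappa> / x\<^sup>2) * x ^ i - exp (- (\<kappa> / x)) * (real i * x ^ (i - 1))) / (x ^ i * x ^ i)) (at x)"
        using 1 by (auto intro!: derivative_eq_intros simp: power2_eq_square)
      show "(exp (- (\<kappa> / x)) * (\<kappa> / x\<^sup>2) * x ^ i - exp (- (\<kappa> / x)) * (real i * x ^ (i - 1))) / (x ^ i * x ^ i) =
        \<kappa> * exp_cutoff \<kappa> (i + 2) x - i * exp_cutoff \<kappa> (i + 1) x"
        using 1 by (cases i) (simp_all add: exp_cutoff_def field_simps power2_eq_square)
    qed
    moreover have "\<forall>\<^sub>F y in nhds x. exp_cutoff \<kappa> i y = exp (- (\<kappa> / y)) / y ^ i"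
      by (rule eventually_mono[OF eventually_nhds_in_open[of "{0<..}"]]) (use 1 in \<open>auto simp: exp_cutoff_def\<close>)
    ultimately show ?thesis by (simp add: DERIV_cong_ev)
  next
    case 2
    have "\<forall>\<^sub>F y in nhds x. exp_cutoff \<kappa> i y = 0"
      by (rule eventually_mono[OF eventually_nhds_in_open[of "{..<0}"]]) (use 2 in \<open>auto simp: exp_cutoff_def\<close>)
    then have "(exp_cutoff \<kappa> i has_real_derivative 0) (at x)"
      by (subst DERIV_cong_ev[where g = "\<lambda>_. 0"]) auto
    then show ?thesis using 2 by (simp add: exp_cutoff_def)
  next
    case 3
    have "((\<lambda>x. exp_cutoff \<kappa> i x / x) \<longlongrightarrow> 0) (at_left 0)"
      by (rule tendsto_eventually) (auto simp: eventually_at_filter exp_cutoff_def)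
    then have "((\<lambda>x. exp_cutoff \<kappa> i x / x) \<longlongrightarrow> 0) (at 0)"
      using exp_cutoff_div_tendsto_0[OF assms] by (simp add: filterlim_at_split)
    moreover have "exp_cutoff \<kappa> j 0 = 0" for j by (simp add: exp_cutoff_def)
    ultimately show ?thesis using 3 by (simp add: has_field_derivative_iff)
  qed
qed

text \<open>A linear space that contains the derivative of each of its members, so smoothness of all
  orders follows from a single differentiation step. Since \<open>test_function\<close> demands all
  derivatives, this replaces any computation of higher ones.\<close>

inductive_set bump_span :: "(real \<Rightarrow> real) set" where
  bump: "\<kappa> > 0 \<Longrightarrow> (\<lambda>x. exp_cutoff \<kappa> i (x - a) * exp_cutoff \<kappa> j (b - x)) \<in> bump_span"
| add: "f \<in> bump_span \<Longrightarrow> g \<in> bump_span \<Longrightarrow> (\<lambda>x. f x + g x) \<in> bump_span"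
| scale: "f \<in> bump_span \<Longrightarrow> (\<lambda>x. c * f x) \<in> bump_span"

lemma bump_span_deriv:
  assumes "f \<in> bump_span"
  shows "\<exists>g\<in>bump_span. \<forall>x. (f has_real_derivative g x) (at x)"
  using assms
proof induction
  case (bump \<kappa> i a j b)
  let ?E = "exp_cutoff \<kappa>"
  let ?g = "\<lambda>x. (\<kappa> * (?E (i + 2) (x - a) * ?E j (b - x)) + (- real i) * (?E (i + 1) (x - a) * ?E j (b - x))) +
     ((- \<kappa>) * (?E i (x - a) * ?E (j + 2) (b - x)) + real j * (?E i (x - a) * ?E (j + 1) (b - x)))"
  have "?g \<in> bump_span" using bump by (intro bump_span.intros)
  moreover have "((\<lambda>x. ?E i (x - a) * ?E j (b - x)) has_real_derivative ?g x) (at x)" for x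
  proof -
    have 1: "((\<lambda>x. ?E i (x - a)) has_real_derivative (\<kappa> * ?E (i + 2) (x - a) - i * ?E (i + 1) (x - a)) * 1) (at x)"
      by (rule DERIV_chain2[OF has_derivative_exp_cutoff[OF bump]]) (auto intro!: derivative_eq_intros)
    have 2: "((\<lambda>x. ?E j (b - x)) has_real_derivative (\<kappa> * ?E (j + 2) (b - x) - j * ?E (j + 1) (b - x)) * (-1)) (at x)"
      by (rule DERIV_chain2[OF has_derivative_exp_cutoff[OF bump]]) (auto intro!: derivative_eq_intros)
    show ?thesis by (rule DERIV_cong[OF DERIV_mult[OF 1 2]]) (simp add: algebra_simps)
  qed
  ultimately show ?case by (intro bexI[of _ ?g] allI)
next
  case (add f g)
  then obtain f' g' where "f' \<in> bump_span" "g' \<in> bump_span" "\<forall>x. (f has_real_derivative f' x) (at x)" "\<forall>x. (g has_real_derivative g' x) (at x)"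
    by blast
  then show ?case
    by (intro bexI[of _ "\<lambda>x. f' x + g' x"]) (auto intro!: bump_span.intros DERIV_add)
next
  case (scale f c)
  then obtain f' where "f' \<in> bump_span" "\<forall>x. (f has_real_derivative f' x) (at x)" by blast
  then show ?case
    by (intro bexI[of _ "\<lambda>x. c * f' x"]) (auto intro!: bump_span.intros DERIV_cmult)
qed

lemma bump_span_iterated_deriv: "f \<in> bump_span \<Longrightarrow> (deriv ^^ n) f \<in> bump_span"
proof (induction n)
  case (Suc n)
  obtain g where "g \<in> bump_span" "\<forall>x. ((deriv ^^ n) f has_real_derivative g x) (at x)"
    using bump_span_deriv Suc by blast
  moreover from this have "deriv ((deriv ^^ n) f) = g" by (intro ext DERIV_imp_deriv) simp
  ultimately show ?case by simp
qed simp

lemma bump_span_isCont: "f \<in> bump_span \<Longrightarrow> isCont f x"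
  using bump_span_deriv DERIV_isCont by blast

text \<open>The primitive that vanishes to the left of the support is constant to its right, with
  the total integral as value; zero mean makes that 0. Its higher derivatives are derivatives of
  \<open>u\<close>, hence exist.\<close>

lemma test_function_primitive:
  assumes u: "u \<in> bump_span" and supp: "\<And>x. x \<notin> {-R..R} \<Longrightarrow> u x = 0"
    and int0: "(\<integral>x. u x \<partial>lborel) = 0"
  obtains \<phi> where "test_function \<phi>" "deriv \<phi> = u"
proof -
  have "\<exists>F. \<forall>x::real. -\<infinity> < ereal x \<longrightarrow> ereal x < \<infinity> \<longrightarrow> (F has_vector_derivative u x) (at x)"
    by (rule einterval_antiderivative) (auto simp: bump_span_isCont u)
  then obtain F where F: "\<And>x. (F has_real_derivative u x) (at x)"
    by (auto simp: has_real_derivative_iff_has_vector_derivative)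
  have FTC: "(\<integral>x. u x * indicator {a..b} x \<partial>lborel) = F b - F a" if "a \<le> b" for a b
    using that by (intro integral_FTC_Icc_real) (auto simp: F bump_span_isCont u)
  define \<phi> where "\<phi> x = F x - F (- \<bar>R\<bar>)" for x
  have D: "(\<phi> has_real_derivative u x) (at x)" for x
    unfolding \<phi>_def[abs_def] by (auto intro!: derivative_eq_intros F)
  then have d: "deriv \<phi> = u" by (intro ext DERIV_imp_deriv)
  have \<phi>0: "\<phi> x = 0" if "x \<notin> {-\<bar>R\<bar>..\<bar>R\<bar>}" for x
  proof (cases "x < 0")
    case True
    then have "x \<le> -\<bar>R\<bar>" using that by auto
    then have "F (-\<bar>R\<bar>) - F x = (\<integral>y. u y * indicator {x..-\<bar>R\<bar>} y \<partial>lborel)" using FTC by simp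
    also have "\<dots> = (\<integral>y. u y * indicator {-\<bar>R\<bar>..-\<bar>R\<bar>} y \<partial>lborel)"
    proof (intro Bochner_Integration.integral_cong refl)
      fix y show "u y * indicator {x..-\<bar>R\<bar>} y = u y * indicator {-\<bar>R\<bar>..-\<bar>R\<bar>} y"
        using supp[of y] \<open>x \<le> -\<bar>R\<bar>\<close> by (cases "y < -\<bar>R\<bar>") (force simp: indicator_def abs_if split: if_splits)+
    qed
    also have "\<dots> = 0" by (subst FTC) auto
    finally show ?thesis by (simp add: \<phi>_def)
  next
    case False
    then have "x \<ge> \<bar>R\<bar>" using that by auto
    then have "F x - F (-\<bar>R\<bar>) = (\<integral>y. u y * indicator {-\<bar>R\<bar>..x} y \<partial>lborel)" using FTC[of "-\<bar>R\<bar>" x] by simp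
    also have "\<dots> = (\<integral>y. u y \<partial>lborel)"
    proof (intro Bochner_Integration.integral_cong refl)
      fix y show "u y * indicator {-\<bar>R\<bar>..x} y = u y"
        using supp[of y] \<open>x \<ge> \<bar>R\<bar>\<close> by (cases "y \<in> {-\<bar>R\<bar>..x}") (force simp: indicator_def abs_if split: if_splits)+
    qed
    finally show ?thesis using int0 by (simp add: \<phi>_def)
  qed
  have "test_function \<phi>"
    unfolding test_function_def
  proof (intro conjI allI)
    fix n x
    show "(deriv ^^ n) \<phi> differentiable at x"
    proof (cases n)
      case 0
      then show ?thesis using D by (auto simp: real_differentiable_def)
    next
      case (Suc m)
      have "(deriv ^^ n) \<phi> = (deriv ^^ m) u" unfolding Suc funpow_Suc_right d[symmetric] by simp
      then show ?thesis
        using bump_span_deriv[OF bump_span_iterated_deriv[OF u, of m]] by (auto simp: real_differentiable_def)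
    qed
    show "bounded {x. \<phi> x \<noteq> 0}"
      by (rule bounded_subset[of "{-\<bar>R\<bar>..\<bar>R\<bar>}"]) (use \<phi>0 in \<open>blast intro: bounded_closed_interval\<close>)+
  qed
  then show ?thesis using d that by blast
qed

text \<open>Open intervals form an intersection-stable generator of the Borel sets, so vanishing
  integrals spread to all Borel sets by Dynkin's argument. The complement step needs the total
  integral, obtained from the intervals \<open>(-n, n)\<close> by dominated convergence.\<close>

lemma AE_zero_if_interval_integrals_zero:
  fixes v :: "real \<Rightarrow> real"
  assumes v: "integrable lborel v" and zero: "\<And>a b. (\<integral>x. indicator {a<..<b} x * v x \<partial>lborel) = 0"
  shows "AE x in lborel. v x = 0"
proof -
  have total: "(\<integral>x. v x \<partial>lborel) = 0"
  proof -
    have "(\<lambda>n. \<integral>x. indicator {-real n<..<real n} x * v x \<partial>lborel) \<longlonglongrightarrow> (\<integral>x. v x \<partial>lborel)"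
    proof (rule integral_dominated_convergence[where w = "\<lambda>x. \<bar>v x\<bar>"])
      show "AE x in lborel. (\<lambda>n. indicator {-real n<..<real n} x * v x) \<longlonglongrightarrow> v x"
      proof (rule AE_I2, rule tendsto_eventually)
        fix x :: real
        obtain N where "\<bar>x\<bar> < real N" using reals_Archimedean2 by blast
        then show "\<forall>\<^sub>F n in sequentially. indicator {-real n<..<real n} x * v x = v x"
          unfolding eventually_sequentially by (intro exI[of _ N]) (auto simp: indicator_def)
      qed
    qed (use v in \<open>auto simp: indicator_def\<close>)
    then show ?thesis by (simp add: zero LIMSEQ_const_iff)
  qed
  have ind: "integrable lborel (\<lambda>x. indicator A x * v x)" if "A \<in> sets borel" for A
    using integrable_real_mult_indicator[OF _ v, of A] that by (simp add: mult.commute)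
  have borel_box: "sets borel = sigma_sets UNIV (range (\<lambda>(a, b). {a<..<b::real}))"
    by (subst borel_eq_box) (auto simp: box_real intro!: arg_cong[of _ _ "sigma_sets UNIV"] image_cong)
  have "(\<integral>x. indicator A x * v x \<partial>lborel) = 0" if "A \<in> sets borel" for A
  proof -
    have "Int_stable (range (\<lambda>(a, b). {a<..<b::real}))"
    proof (rule Int_stableI_image)
      fix p q :: "real \<times> real"
      show "\<exists>k\<in>UNIV. (case p of (a, b) \<Rightarrow> {a<..<b}) \<inter> (case q of (a, b) \<Rightarrow> {a<..<b}) = (case k of (a, b) \<Rightarrow> {a<..<b})"
        by (rule bexI[of _ "(max (fst p) (fst q), min (snd p) (snd q))"]) (auto split: prod.splits)
    qed
    moreover have "range (\<lambda>(a, b). {a<..<b::real}) \<subseteq> Pow UNIV" by simp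
    moreover have "A \<in> sigma_sets UNIV (range (\<lambda>(a, b). {a<..<b::real}))"
      using that by (simp add: borel_box)
    ultimately show ?thesis
    proof (induction rule: sigma_sets_induct_disjoint)
      case (compl A)
      then have [measurable]: "A \<in> sets borel" unfolding borel_box by simp
      have "(\<integral>x. indicator (UNIV - A) x * v x \<partial>lborel) = (\<integral>x. v x - indicator A x * v x \<partial>lborel)"
        by (intro Bochner_Integration.integral_cong) (auto simp: indicator_def)
      then show ?case using compl total by (simp add: v ind)
    next
      case (union A)
      have A: "A i \<in> sets borel" for i using union(2) unfolding borel_box by auto
      have U: "(\<Union>i. A i) \<in> sets borel" using A by auto
      have "(\<integral>x\<in>(\<Union>i. A i). v x \<partial>lborel) = (\<Sum>i. (\<integral>x\<in>(A i). v x \<partial>lborel))"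
        by (rule lebesgue_integral_countable_add)
           (use A union(1) ind[OF U] in \<open>auto simp: disjoint_family_on_def set_integrable_def\<close>)
      then show ?case using union(3) by (simp add: set_lebesgue_integral_def)
    qed (use zero in auto)
  qed
  then show ?thesis
    using sigma_finite_measure.density_zero[OF lborel.sigma_finite_measure_axioms v] by (simp add: set_lebesgue_integral_def)
qed

lemma borel_measurable_locally_integrable:
  fixes f :: "real \<Rightarrow> real"
  assumes "\<And>a b. set_integrable lborel {a..b} f"
  shows "f \<in> borel_measurable borel"
proof (rule borel_measurable_LIMSEQ_real)
  show "(\<lambda>x. indicator {-real n..real n} x * f x) \<in> borel_measurable borel" for n
    using assms[of "-real n" "real n"] by (auto simp: set_integrable_def dest: borel_measurable_integrable)
  fix x
  obtain N where "\<bar>x\<bar> < real N" using reals_Archimedean2 by blast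
  then show "(\<lambda>n. indicator {-real n..real n} x * f x) \<longlonglongrightarrow> f x"
    by (intro tendsto_eventually) (auto simp: eventually_sequentially indicator_def intro!: exI[of _ N])
qed

lemma integrable_mult_bounded_support:
  fixes f g :: "real \<Rightarrow> real"
  assumes f: "\<And>a b. set_integrable lborel {a..b} f" and [measurable]: "g \<in> borel_measurable borel"
    and supp: "\<And>x. x \<notin> {a..b} \<Longrightarrow> g x = 0" and bd: "\<And>x. \<bar>g x\<bar> \<le> B"
  shows "integrable lborel (\<lambda>x. f x * g x)"
proof (rule Bochner_Integration.integrable_bound)
  have [measurable]: "f \<in> borel_measurable borel" by (rule borel_measurable_locally_integrable[OF f])
  show "(\<lambda>x. f x * g x) \<in> borel_measurable lborel" by measurable
  show "integrable lborel (\<lambda>x. B * (indicator {a..b} x *\<^sub>R f x))"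
    using f by (auto simp: set_integrable_def)
  show "AE x in lborel. norm (f x * g x) \<le> norm (B * (indicator {a..b} x *\<^sub>R f x))"
  proof (rule AE_I2)
    fix x
    show "norm (f x * g x) \<le> norm (B * (indicator {a..b} x *\<^sub>R f x))"
      using supp[of x] mult_left_mono[OF order_trans[OF bd[of x] abs_ge_self], of "\<bar>f x\<bar>"]
      by (cases "x \<in> {a..b}") (auto simp: abs_mult mult_ac)
  qed
qed

text \<open>
  As \<open>n\<close> grows these test functions converge boundedly to the indicator of the interval, so no
  mollifier is needed.
\<close>

definition interval_bump :: "nat \<Rightarrow> real \<Rightarrow> real \<Rightarrow> real \<Rightarrow> real" where
  "interval_bump n a b x = exp_cutoff (1 / Suc n) 0 (x - a) * exp_cutoff (1 / Suc n) 0 (b - x)"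

lemma interval_bump_in_span: "interval_bump n a b \<in> bump_span"
  unfolding interval_bump_def by (rule bump_span.bump) simp

lemma interval_bump_measurable [measurable]: "interval_bump n a b \<in> borel_measurable borel"
  by (intro borel_measurable_continuous_onI continuous_at_imp_continuous_on ballI bump_span_isCont interval_bump_in_span)

lemma interval_bump_bounds: "0 \<le> interval_bump n a b x" "interval_bump n a b x \<le> 1"
  by (auto simp: interval_bump_def exp_cutoff_def intro!: mult_le_one)

lemma interval_bump_support: "x \<notin> {a<..<b} \<Longrightarrow> interval_bump n a b x = 0"
  by (auto simp: interval_bump_def exp_cutoff_def)

lemma interval_bump_tendsto: "(\<lambda>n. interval_bump n a b x) \<longlonglongrightarrow> indicator {a<..<b} x"
proof (cases "x \<in> {a<..<b}")
  case True
  have "(\<lambda>n. exp (- (1 / Suc n / y))) \<longlonglongrightarrow> 1" for y :: real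
    using tendsto_exp[OF tendsto_minus[OF tendsto_divide[OF lim_1_over_n[THEN LIMSEQ_Suc] tendsto_const[of y]]]]
    by (cases "y = 0") auto
  from tendsto_mult[OF this[of "x - a"] this[of "b - x"]] True show ?thesis
    by (simp add: interval_bump_def exp_cutoff_def)
qed (simp add: interval_bump_support)

lemma interval_bump_integral_tendsto:
  fixes f :: "real \<Rightarrow> real"
  assumes f: "\<And>a b. set_integrable lborel {a..b} f"
  shows "(\<lambda>n. \<integral>x. f x * interval_bump n a b x \<partial>lborel) \<longlonglongrightarrow> (\<integral>x. f x * indicator {a<..<b} x \<partial>lborel)"
proof (rule integral_dominated_convergence[where w = "\<lambda>x. \<bar>indicator {a..b} x *\<^sub>R f x\<bar>"])
  note [measurable] = borel_measurable_locally_integrable[OF f]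
  show "(\<lambda>x. f x * indicator {a<..<b} x) \<in> borel_measurable lborel" "\<And>n. (\<lambda>x. f x * interval_bump n a b x) \<in> borel_measurable lborel"
    by measurable
  show "integrable lborel (\<lambda>x. \<bar>indicator {a..b} x *\<^sub>R f x\<bar>)"
    using f[of a b] by (auto simp: set_integrable_def)
  show "AE x in lborel. (\<lambda>n. f x * interval_bump n a b x) \<longlonglongrightarrow> f x * indicator {a<..<b} x"
    by (intro AE_I2 tendsto_intros interval_bump_tendsto)
  show "AE x in lborel. norm (f x * interval_bump n a b x) \<le> \<bar>indicator {a..b} x *\<^sub>R f x\<bar>" for n
  proof (rule AE_I2)
    fix x
    show "norm (f x * interval_bump n a b x) \<le> \<bar>indicator {a..b} x *\<^sub>R f x\<bar>"
      using interval_bump_support[of x a b n] interval_bump_bounds[of n a b x]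
      by (cases "x \<in> {a<..<b}") (auto simp: abs_mult mult_left_le)
  qed
qed

text \<open>Zero-mean combinations of two bumps are derivatives of test functions. Testing with them
  and letting the bumps tend to indicators shows that the integral of \<open>u\<close> over an
  interval is proportional to its length; \<open>C\<close> is the constant of proportionality, read
  off on (0,1).\<close>

lemma du_Bois_Reymond:
  fixes u :: "real \<Rightarrow> real"
  assumes u: "\<And>a b. set_integrable lborel {a..b} u"
    and weak: "\<And>\<phi>. test_function \<phi> \<Longrightarrow> (\<integral>x. u x * deriv \<phi> x \<partial>lborel) = 0"
  shows "\<exists>C. AE x in lborel. u x = C"
proof -
  have one: "set_integrable lborel {a..b} (\<lambda>_. 1::real)" for a b :: real
    by (simp add: set_integrable_def integrable_indicator_iff emeasure_lborel_Icc_eq)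
  have ib: "integrable lborel (\<lambda>x. f x * interval_bump n a b x)" if "\<And>a b. set_integrable lborel {a..b} f" for f n a b
    using that by (rule integrable_mult_bounded_support[where a = a and b = b and B = 1])
      (auto simp: interval_bump_bounds intro!: interval_bump_support)
  define C where "C = (\<integral>x. u x * indicator {0<..<1} x \<partial>lborel)"
  have lim: "(\<integral>x. u x * indicator {a<..<b} x \<partial>lborel) = (b - a) * C" if "a \<le> b" for a b
  proof -
    let ?m = "\<lambda>n a b. \<integral>x. 1 * interval_bump n a b x \<partial>lborel"
    let ?u = "\<lambda>n a b. \<integral>x. u x * interval_bump n a b x \<partial>lborel"
    have eq: "?m n 0 1 * ?u n a b = ?m n a b * ?u n 0 1" for n
    proof -
      \<comment> \<open>The coefficients are the integrals of the opposite bumps, so the mean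
        cancels without a division.\<close>
      let ?f = "\<lambda>x. ?m n 0 1 * interval_bump n a b x + (- ?m n a b) * interval_bump n 0 1 x"
      have f: "?f \<in> bump_span" by (intro bump_span.intros interval_bump_in_span)
      have supp: "?f x = 0" if "x \<notin> {-(\<bar>a\<bar> + \<bar>b\<bar> + 1)..\<bar>a\<bar> + \<bar>b\<bar> + 1}" for x
      proof -
        have "x \<notin> {a<..<b}" "x \<notin> {0<..<1}" using that by auto
        then show ?thesis by (simp add: interval_bump_support)
      qed
      have "(\<integral>x. ?f x \<partial>lborel) = ?m n 0 1 * ?m n a b + (- ?m n a b) * ?m n 0 1"
        using ib[OF one] by (subst Bochner_Integration.integral_add) auto
      then have "(\<integral>x. ?f x \<partial>lborel) = 0" by simp
      then obtain \<phi> where \<phi>: "test_function \<phi>" "deriv \<phi> = ?f"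
        using test_function_primitive[OF f supp] by blast
      have "0 = (\<integral>x. u x * ?f x \<partial>lborel)" using weak[OF \<phi>(1)] \<phi>(2) by simp
      also have "\<dots> = (\<integral>x. ?m n 0 1 * (u x * interval_bump n a b x) + (- ?m n a b) * (u x * interval_bump n 0 1 x) \<partial>lborel)"
        by (intro Bochner_Integration.integral_cong) (auto simp: algebra_simps)
      also have "\<dots> = ?m n 0 1 * ?u n a b + (- ?m n a b) * ?u n 0 1"
        using ib[OF u] by (subst Bochner_Integration.integral_add) (auto simp del: mult_minus_left)
      finally show ?thesis by simp
    qed
    have "(\<lambda>n. ?m n 0 1 * ?u n a b) \<longlonglongrightarrow> 1 * (\<integral>x. u x * indicator {a<..<b} x \<partial>lborel)"
      using interval_bump_integral_tendsto[OF one, of 0 1] by (intro tendsto_intros interval_bump_integral_tendsto u) auto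
    moreover have "(\<lambda>n. ?m n a b * ?u n 0 1) \<longlonglongrightarrow> (b - a) * C"
      unfolding C_def using interval_bump_integral_tendsto[OF one, of a b] that by (intro tendsto_intros interval_bump_integral_tendsto u) auto
    ultimately show ?thesis using LIMSEQ_unique unfolding eq by fastforce
  qed
  have ui: "integrable lborel (\<lambda>x. indicator {a<..<b} x * (u x - C))" for a b
  proof -
    have "integrable lborel (\<lambda>x. (u x - C) * indicator {a<..<b} x)"
      by (rule integrable_mult_bounded_support[where a = a and b = b and B = 1])
         (auto simp: indicator_def intro!: set_integral_diff u set_integrable_mult_right one[of _ _, THEN set_integrable_mult_right[of C], simplified])
    then show ?thesis by (simp add: mult.commute)
  qed
  have z: "(\<integral>x. indicator {a<..<b} x * (u x - C) \<partial>lborel) = 0" for a b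
  proof (cases "a \<le> b")
    case True
    have i: "integrable lborel (\<lambda>x. u x * indicator {a<..<b} x)"
      by (rule integrable_mult_bounded_support[where a = a and b = b and B = 1]) (auto simp: u)
    have "(\<integral>x. indicator {a<..<b} x * (u x - C) \<partial>lborel) = (\<integral>x. u x * indicator {a<..<b} x - C * indicator {a<..<b} x \<partial>lborel)"
      by (intro Bochner_Integration.integral_cong) (auto simp: algebra_simps)
    also have "\<dots> = 0" using True i lim[OF True] by (subst Bochner_Integration.integral_diff) auto
    finally show ?thesis .
  qed auto
  \<comment> \<open>The difference \<open>u - C\<close> is only locally integrable, so the
    almost-everywhere statement is proved on each \<open>(-n, n)\<close> and then combined.\<close>
  have "AE x in lborel. \<forall>n::nat. indicator {-real n<..<real n} x * (u x - C) = 0"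
    unfolding AE_all_countable
  proof
    fix n :: nat
    show "AE x in lborel. indicator {-real n<..<real n} x * (u x - C) = 0"
    proof (rule AE_zero_if_interval_integrals_zero[OF ui])
      fix a b :: real
      have "(\<integral>x. indicator {a<..<b} x * (indicator {-real n<..<real n} x * (u x - C)) \<partial>lborel) =
            (\<integral>x. indicator {max a (-real n)<..<min b (real n)} x * (u x - C) \<partial>lborel)"
        by (intro Bochner_Integration.integral_cong) (auto simp: indicator_def)
      then show "(\<integral>x. indicator {a<..<b} x * (indicator {-real n<..<real n} x * (u x - C)) \<partial>lborel) = 0"
        using z by simp
    qed
  qed
  then have "AE x in lborel. u x = C"
  proof (rule AE_mp, intro AE_I2 impI)
    fix x assume *: "\<forall>n::nat. indicator {-real n<..<real n} x * (u x - C) = 0"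
    obtain N where "\<bar>x\<bar> < real N" using reals_Archimedean2 by blast
    then show "u x = C" using *[rule_format, of N] by (auto simp: indicator_def)
  qed
  then show ?thesis ..
qed

section \<open>Weak derivatives and primitives\<close>

lemma isCont_primitive:
  fixes d V :: "real \<Rightarrow> real"
  assumes d: "\<And>a b. set_integrable lborel {a..b} d"
    and V: "\<And>a b. a \<le> b \<Longrightarrow> V b - V a = (\<integral>x. indicator {a..b} x * d x \<partial>lborel)"
  shows "isCont V x"
proof -
  have eq: "V y = V (x - 1) + integral {x-1..y} d" if "y \<in> {x-1..x+1}" for y
    using V[of "x-1" y] set_borel_integral_eq_integral(2)[OF d, of "x-1" y] that
    by (simp add: set_lebesgue_integral_def)
  have "continuous_on {x-1..x+1} (\<lambda>y. V (x - 1) + integral {x-1..y} d)"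
    using set_borel_integral_eq_integral(1)[OF d] by (intro continuous_intros indefinite_integral_continuous_1)
  then have "continuous_on {x-1..x+1} V" by (rule continuous_on_eq) (rule eq[symmetric])
  then show ?thesis by (rule continuous_on_interior) simp
qed

lemma test_functionD:
  assumes "test_function \<phi>"
  shows "\<exists>R B. R > 0 \<and> (\<forall>x. x \<notin> {-R..R} \<longrightarrow> \<phi> x = 0 \<and> deriv \<phi> x = 0) \<and>
    (\<forall>x. (\<phi> has_real_derivative deriv \<phi> x) (at x) \<and> isCont (deriv \<phi>) x \<and> \<bar>deriv \<phi> x\<bar> \<le> B)"
proof -
  have diff: "(deriv ^^ n) \<phi> differentiable at x" for n x using assms by (auto simp: test_function_def)
  have D: "(\<phi> has_real_derivative deriv \<phi> x) (at x)" for x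
    using diff[of 0 x] by (simp add: DERIV_deriv_iff_real_differentiable)
  have C: "isCont (deriv \<phi>) x" for x
    using diff[of 1 x] by (simp add: differentiable_imp_continuous_within)
  obtain R where R: "R > 0" "\<And>x. \<phi> x \<noteq> 0 \<Longrightarrow> \<bar>x\<bar> \<le> R"
    using assms unfolding test_function_def bounded_pos by auto
  have 0: "\<phi> x = 0" if "x \<notin> {-R..R}" for x using R(2)[of x] that by (cases "\<phi> x = 0") auto
  have d0: "deriv \<phi> x = 0" if "x \<notin> {-R..R}" for x
  proof -
    have "open (- {-R..R})" by (simp add: open_Compl)
    then have "\<forall>\<^sub>F y in nhds x. \<phi> y = 0"
      using that 0 by (intro eventually_mono[OF eventually_nhds_in_open[of "- {-R..R}"]]) auto
    then have "(\<phi> has_real_derivative 0) (at x)"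
      by (subst DERIV_cong_ev[where g = "\<lambda>_. 0"]) auto
    then show ?thesis by (rule DERIV_imp_deriv)
  qed
  have "compact (deriv \<phi> ` {-R..R})" using C by (intro compact_continuous_image continuous_at_imp_continuous_on) auto
  then have "bounded (deriv \<phi> ` {-R..R})" by (rule compact_imp_bounded)
  then obtain B where B: "B > 0" "\<And>x. x \<in> {-R..R} \<Longrightarrow> \<bar>deriv \<phi> x\<bar> \<le> B"
    unfolding bounded_pos by auto
  then have "\<bar>deriv \<phi> x\<bar> \<le> B" for x using d0[of x] by (cases "x \<in> {-R..R}") auto
  with R(1) 0 d0 D C show ?thesis by blast
qed

text \<open>Integration by parts when \<open>d\<close> is only locally integrable: write
  \<open>V\<close> as an integral of \<open>d\<close> and \<open>- \<phi> x\<close> as the integral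
  of \<open>deriv \<phi>\<close> from \<open>x\<close> on, and exchange the two
  integrations.\<close>

lemma weak_deriv_primitive:
  fixes d V :: "real \<Rightarrow> real"
  assumes d: "\<And>a b. set_integrable lborel {a..b} d"
    and V: "\<And>a b. a \<le> b \<Longrightarrow> V b - V a = (\<integral>x. indicator {a..b} x * d x \<partial>lborel)"
  shows "weak_deriv V d"
  unfolding weak_deriv_def
proof (intro conjI allI impI)
  have contV: "continuous_on A V" for A
    by (intro continuous_at_imp_continuous_on ballI isCont_primitive[OF d V])
  have Vint: "set_integrable lborel {a..b} V" for a b
    by (intro borel_integrable_atLeastAtMost' contV)
  then show "set_integrable lborel {a..b} V" "set_integrable lborel {a..b} d" for a b
    using d by auto
  fix \<phi> assume t: "test_function \<phi>"
  obtain R B where R: "R > 0" "\<And>x. x \<notin> {-R..R} \<Longrightarrow> \<phi> x = 0" "\<And>x. x \<notin> {-R..R} \<Longrightarrow> deriv \<phi> x = 0"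
    and D: "\<And>x. (\<phi> has_real_derivative deriv \<phi> x) (at x)" and C: "\<And>x. isCont (deriv \<phi>) x"
    and B': "\<And>x. \<bar>deriv \<phi> x\<bar> \<le> B"
    using test_functionD[OF t] by blast
  let ?\<phi>' = "deriv \<phi>"
  have [measurable]: "?\<phi>' \<in> borel_measurable borel"
    using C by (intro borel_measurable_continuous_onI continuous_at_imp_continuous_on) auto
  have [measurable]: "d \<in> borel_measurable borel" by (rule borel_measurable_locally_integrable[OF d])
  have FTC: "(\<integral>x. ?\<phi>' x * indicator {a..b} x \<partial>lborel) = \<phi> b - \<phi> a" if "a \<le> b" for a b
    using that by (intro integral_FTC_Icc_real) (auto simp: D C)
  have \<phi>R: "\<phi> (R + 1) = 0" "\<phi> (- R - 1) = 0" using R by auto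
  have total: "(\<integral>x. ?\<phi>' x \<partial>lborel) = 0"
  proof -
    have "(\<integral>x. ?\<phi>' x \<partial>lborel) = (\<integral>x. ?\<phi>' x * indicator {-R-1..R+1} x \<partial>lborel)"
    proof (intro Bochner_Integration.integral_cong refl)
      fix x show "?\<phi>' x = ?\<phi>' x * indicator {-R-1..R+1} x"
        using R(3)[of x] by (cases "x \<in> {-R..R}") (auto simp: indicator_def)
    qed
    then show ?thesis using FTC[of "-R-1" "R+1"] R(1) \<phi>R by simp
  qed
  \<comment> \<open>Integrating in \<open>x\<close> produces the increment of \<open>V\<close> from
    \<open>-R-1\<close> to \<open>y\<close>; integrating in \<open>y\<close> produces
    \<open>- \<phi> x\<close>. The cutoff makes \<open>d\<close> integrable on the line, and the
    margin of 1 puts both ends strictly outside the interval that carries \<phi>.\<close>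
  let ?f = "\<lambda>x y. indicator {-R-1..R+1} x * d x * (indicator {x..} y * ?\<phi>' y)"
  have dI: "integrable lborel (\<lambda>x. indicator {-R-1..R+1} x * d x)" using d[of "-R-1" "R+1"] by (simp add: set_integrable_def)
  have \<phi>I: "integrable lborel (\<lambda>y. ?\<phi>' y)"
  proof -
    have "integrable lborel (\<lambda>x. 1 * ?\<phi>' x)"
      by (rule integrable_mult_bounded_support[where a = "-R" and b = R and B = B])
         (use B' R(3) in \<open>auto simp: set_integrable_def integrable_indicator_iff emeasure_lborel_Icc_eq\<close>)
    then show ?thesis by simp
  qed
  have "integrable (lborel \<Otimes>\<^sub>M lborel) (\<lambda>w. (indicator {-R-1..R+1} (fst w) * d (fst w)) * ?\<phi>' (snd w))"
  proof (rule lborel_pair.Fubini_integrable)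
    show "(\<lambda>w. (indicator {-R-1..R+1} (fst w) * d (fst w)) * ?\<phi>' (snd w)) \<in> borel_measurable (lborel \<Otimes>\<^sub>M lborel)"
      by measurable
    have "(\<integral>y. norm ((indicator {-R-1..R+1} (fst (x, y)) * d (fst (x, y))) * ?\<phi>' (snd (x, y))) \<partial>lborel) =
       norm (indicator {-R-1..R+1} x * d x) * (\<integral>y. norm (?\<phi>' y) \<partial>lborel)" for x
      by (simp add: abs_mult)
    then show "integrable lborel (\<lambda>x. \<integral>y. norm ((indicator {-R-1..R+1} (fst (x, y)) * d (fst (x, y))) * ?\<phi>' (snd (x, y))) \<partial>lborel)"
      using integrable_norm[OF dI] by (simp only: integrable_mult_left)
    show "AE x in lborel. integrable lborel (\<lambda>y. (indicator {-R-1..R+1} (fst (x, y)) * d (fst (x, y))) * ?\<phi>' (snd (x, y)))"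
      using \<phi>I by simp
  qed
  then have fI: "integrable (lborel \<Otimes>\<^sub>M lborel) (\<lambda>(x, y). ?f x y)"
  proof (rule Bochner_Integration.integrable_bound)
    have "(\<lambda>w. if fst w \<le> snd w then indicator {-R-1..R+1} (fst w) * d (fst w) * ?\<phi>' (snd w) else 0) \<in> borel_measurable (lborel \<Otimes>\<^sub>M lborel)"
      by measurable
    also have "(\<lambda>w. if fst w \<le> snd w then indicator {-R-1..R+1} (fst w) * d (fst w) * ?\<phi>' (snd w) else 0) = (\<lambda>(x, y). ?f x y)"
      by (auto simp: indicator_def)
    finally show "(\<lambda>(x, y). ?f x y) \<in> borel_measurable (lborel \<Otimes>\<^sub>M lborel)" .
  qed (auto simp: indicator_def)
  \<comment> \<open>Since \<open>deriv \<phi>\<close> has total integral 0, a constant may be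
    subtracted from \<open>V\<close>.\<close>
  have "(\<integral>y. V y * ?\<phi>' y \<partial>lborel) = (\<integral>y. (V y - V (-R-1)) * ?\<phi>' y \<partial>lborel)"
  proof -
    have "integrable lborel (\<lambda>y. V y * ?\<phi>' y)"
      by (rule integrable_mult_bounded_support[where a = "-R" and b = R and B = B]) (use B' R(3) Vint in auto)
    then show ?thesis using \<phi>I total by (simp add: left_diff_distrib)
  qed
  also have "\<dots> = (\<integral>y. (\<integral>x. ?f x y \<partial>lborel) \<partial>lborel)"
  proof (intro Bochner_Integration.integral_cong refl)
    fix y
    show "(V y - V (-R-1)) * ?\<phi>' y = (\<integral>x. ?f x y \<partial>lborel)"
    proof (cases "y \<in> {-R..R}")
      case True
      have "?f x y = (indicator {-R-1..y} x * d x) * ?\<phi>' y" for x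
        using True by (auto simp: indicator_def)
      then show ?thesis using V[of "-R-1" y] True by (simp only: integral_mult_left_zero) simp
    qed (simp add: R)
  qed
  also have "\<dots> = (\<integral>x. (\<integral>y. ?f x y \<partial>lborel) \<partial>lborel)"
    by (rule lborel_pair.Fubini_integral[OF fI])
  also have "\<dots> = (\<integral>x. - (d x * \<phi> x) \<partial>lborel)"
  proof (intro Bochner_Integration.integral_cong refl)
    fix x
    show "(\<integral>y. ?f x y \<partial>lborel) = - (d x * \<phi> x)"
    proof (cases "x \<in> {-R-1..R+1}")
      case True
      have "(\<integral>y. indicator {x..} y * ?\<phi>' y \<partial>lborel) = (\<integral>y. ?\<phi>' y * indicator {x..R+1} y \<partial>lborel)"
      proof (intro Bochner_Integration.integral_cong refl)
        fix y show "indicator {x..} y * ?\<phi>' y = ?\<phi>' y * indicator {x..R+1} y"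
          using R(3)[of y] by (cases "y \<in> {-R..R}") (auto simp: indicator_def)
      qed
      also have "\<dots> = - \<phi> x" using True FTC[of x "R+1"] \<phi>R by simp
      finally show ?thesis using True by simp
    qed (use R in auto)
  qed
  finally show "(\<integral>y. V y * ?\<phi>' y \<partial>lborel) = - (\<integral>y. d y * \<phi> y \<partial>lborel)" by simp
qed

lemma primitive_exists:
  fixes d :: "real \<Rightarrow> real"
  assumes d: "\<And>a b. set_integrable lborel {a..b} d"
  obtains V where "\<And>a b. a \<le> b \<Longrightarrow> V b - V a = (\<integral>x. indicator {a..b} x * d x \<partial>lborel)"
proof
  fix a b :: real assume ab: "a \<le> b"
  define I where "I a b = (\<integral>x. indicator {a..b} x * d x \<partial>lborel)" for a b
  let ?V = "\<lambda>y. if 0 \<le> y then I 0 y else - I y 0"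
  have split: "I a c = I a b + I b c" if "a \<le> b" "b \<le> c" for a b c
  proof -
    have "integrable lborel (\<lambda>x. indicator {a..b} x * d x)" "integrable lborel (\<lambda>x. indicator {b..c} x * d x)"
      using d by (auto simp: set_integrable_def)
    then have "I a b + I b c = (\<integral>x. indicator {a..b} x * d x + indicator {b..c} x * d x \<partial>lborel)"
      by (simp add: I_def)
    also have "\<dots> = I a c"
      unfolding I_def
    proof (rule integral_cong_AE)
      show "AE x in lborel. indicator {a..b} x * d x + indicator {b..c} x * d x = indicator {a..c} x * d x"
        using AE_lborel_singleton[of b] by eventually_elim (use that in \<open>auto simp: indicator_def\<close>)
    qed (use borel_measurable_locally_integrable[OF d] in measurable)
    finally show ?thesis ..
  qed
  show "?V b - ?V a = (\<integral>x. indicator {a..b} x * d x \<partial>lborel)"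
    unfolding I_def[of a b, symmetric]
    using split[of a 0 b] split[of 0 a b] split[of a b 0] ab by auto
qed

text \<open>Subtracting a primitive of \<open>d\<close> from \<psi> leaves a function with weak
  derivative 0, which \<open>du_Bois_Reymond\<close> makes constant almost everywhere. The
  level-crossing arguments below run on this representative.\<close>

lemma weak_deriv_continuous_representative:
  assumes "weak_deriv \<psi> d"
  obtains V where "AE x in lborel. \<psi> x = V x" "\<And>x. isCont V x"
    "\<And>a b. a \<le> b \<Longrightarrow> V b - V a = (\<integral>x. indicator {a..b} x * d x \<partial>lborel)"
proof -
  have \<psi>: "\<And>a b. set_integrable lborel {a..b} \<psi>" and d: "\<And>a b. set_integrable lborel {a..b} d"
    and weak: "\<And>\<phi>. test_function \<phi> \<Longrightarrow> (\<integral>y. \<psi> y * deriv \<phi> y \<partial>lborel) = - (\<integral>y. d y * \<phi> y \<partial>lborel)"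
    using assms unfolding weak_deriv_def by auto
  obtain V where V: "\<And>a b. a \<le> b \<Longrightarrow> V b - V a = (\<integral>x. indicator {a..b} x * d x \<partial>lborel)"
    using primitive_exists[OF d] by blast
  have W: "weak_deriv V d" using weak_deriv_primitive[OF d V] .
  then have Vi: "\<And>a b. set_integrable lborel {a..b} V" unfolding weak_deriv_def by auto
  have "\<exists>C. AE x in lborel. \<psi> x - V x = C"
  proof (rule du_Bois_Reymond)
    show "set_integrable lborel {a..b} (\<lambda>x. \<psi> x - V x)" for a b
      using \<psi> Vi by (rule set_integral_diff)
    fix \<phi> assume t: "test_function \<phi>"
    obtain R B where R: "R > 0" "\<And>x. x \<notin> {-R..R} \<Longrightarrow> deriv \<phi> x = 0" and C: "\<And>x. isCont (deriv \<phi>) x"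
      and B': "\<And>x. \<bar>deriv \<phi> x\<bar> \<le> B"
      using test_functionD[OF t] by blast
    have [measurable]: "deriv \<phi> \<in> borel_measurable borel"
      using C by (intro borel_measurable_continuous_onI continuous_at_imp_continuous_on) auto
    have "integrable lborel (\<lambda>y. \<psi> y * deriv \<phi> y)" "integrable lborel (\<lambda>y. V y * deriv \<phi> y)"
      by (rule integrable_mult_bounded_support[where a = "-R" and b = R and B = B]; use B' R(2) Vi \<psi> in auto)+
    then show "(\<integral>x. (\<psi> x - V x) * deriv \<phi> x \<partial>lborel) = 0"
      using weak[OF t] W t by (simp add: left_diff_distrib weak_deriv_def)
  qed
  then obtain C where C: "AE x in lborel. \<psi> x - V x = C" by blast
  show ?thesis
  proof (rule that[of "\<lambda>x. V x + C"])
    show "AE x in lborel. \<psi> x = V x + C" using C by eventually_elim simp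
    show "isCont (\<lambda>x. V x + C) x" for x by (intro continuous_intros isCont_primitive[OF d V])
  qed (simp add: V)
qed

section \<open>Lower bound for the energy\<close>

text \<open>Take for \<beta> the first point of \<open>[y1, y0]\<close> where \<open>V\<close> is at
  least \<open>b\<close>, then for \<alpha> the last point before it where \<open>V\<close> is at
  most \<open>a\<close>. In between, \<open>V\<close> can lie only strictly inside the band.\<close>

lemma upcrossing_exists:
  fixes V :: "real \<Rightarrow> real"
  assumes V: "\<And>x. isCont V x" and "y1 < y0" "V y1 \<le> a" "a < b" "b \<le> V y0"
  shows "\<exists>\<alpha> \<beta>. y1 \<le> \<alpha> \<and> \<alpha> < \<beta> \<and> \<beta> \<le> y0 \<and> V \<alpha> \<le> a \<and> b \<le> V \<beta> \<and> (\<forall>y. \<alpha> < y \<longrightarrow> y < \<beta> \<longrightarrow> a < V y \<and> V y < b)"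
proof -
  have cont: "continuous_on S V" for S using V by (simp add: continuous_at_imp_continuous_on)
  have "closed {y. b \<le> V y}" "closed {y. V y \<le> a}"
    by (intro closed_Collect_le continuous_intros cont)+
  then have c: "compact ({y1..y0} \<inter> {y. b \<le> V y})" "compact ({y1..x} \<inter> {y. V y \<le> a})" for x
    by (auto intro: compact_Int_closed)
  have "y0 \<in> {y1..y0} \<inter> {y. b \<le> V y}" using assms by auto
  then obtain \<beta> where \<beta>: "\<beta> \<in> {y1..y0}" "b \<le> V \<beta>" "\<And>y. y \<in> {y1..y0} \<Longrightarrow> b \<le> V y \<Longrightarrow> \<beta> \<le> y"
    using compact_attains_inf[OF c(1)] by blast
  have "y1 \<in> {y1..\<beta>} \<inter> {y. V y \<le> a}" using assms \<beta> by auto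
  then obtain \<alpha> where \<alpha>: "\<alpha> \<in> {y1..\<beta>}" "V \<alpha> \<le> a" "\<And>y. y \<in> {y1..\<beta>} \<Longrightarrow> V y \<le> a \<Longrightarrow> y \<le> \<alpha>"
    using compact_attains_sup[OF c(2)[of \<beta>]] by blast
  have "\<alpha> \<noteq> \<beta>" using \<alpha> \<beta> assms by auto
  moreover have "a < V y \<and> V y < b" if "\<alpha> < y" "y < \<beta>" for y
    using \<alpha>(1) \<alpha>(3)[of y] \<beta>(1) \<beta>(3)[of y] that by (auto simp: not_le[symmetric])
  ultimately show ?thesis using \<alpha> \<beta> by (intro exI[of _ \<alpha>] exI[of _ \<beta>]) auto
qed

lemma downcrossing_exists:
  fixes V :: "real \<Rightarrow> real"
  assumes V: "\<And>x. isCont V x" and "y0 < y1" "V y1 \<le> a" "a < b" "b \<le> V y0"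
  shows "\<exists>\<alpha> \<beta>. y0 \<le> \<alpha> \<and> \<alpha> < \<beta> \<and> \<beta> \<le> y1 \<and> V \<beta> \<le> a \<and> b \<le> V \<alpha> \<and> (\<forall>y. \<alpha> < y \<longrightarrow> y < \<beta> \<longrightarrow> a < V y \<and> V y < b)"
proof -
  have "isCont (\<lambda>x. V (- x)) x" for x by (rule isCont_o2[OF _ V]) simp
  from upcrossing_exists[OF this, of "-y1" "-y0" a b] assms
  obtain \<alpha> \<beta> where *: "-y1 \<le> \<alpha>" "\<alpha> < \<beta>" "\<beta> \<le> -y0" "V (-\<alpha>) \<le> a" "b \<le> V (-\<beta>)"
    "\<forall>y. \<alpha> < y \<longrightarrow> y < \<beta> \<longrightarrow> a < V (-y) \<and> V (-y) < b" by auto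
  have "a < V y \<and> V y < b" if "-\<beta> < y" "y < -\<alpha>" for y
    using *(6)[rule_format, of "-y"] that by auto
  with * show ?thesis by (intro exI[of _ "-\<beta>"] exI[of _ "-\<alpha>"]) auto
qed

lemma crossing_variation:
  fixes d V :: "real \<Rightarrow> real"
  assumes d: "\<And>a b. set_integrable lborel {a..b} d"
    and V: "\<And>a b. a \<le> b \<Longrightarrow> V b - V a = (\<integral>x. indicator {a..b} x * d x \<partial>lborel)"
    and "\<alpha> \<le> \<beta>" "c \<le> \<bar>V \<beta> - V \<alpha>\<bar>"
  shows "ennreal c \<le> (\<integral>\<^sup>+ y. indicator {\<alpha><..<\<beta>} y * ennreal \<bar>d y\<bar> \<partial>lborel)"
proof -
  have i: "integrable lborel (\<lambda>x. indicator {\<alpha>..\<beta>} x * d x)" using d[of \<alpha> \<beta>] by (simp add: set_integrable_def)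
  have "c \<le> (\<integral>x. \<bar>indicator {\<alpha>..\<beta>} x * d x\<bar> \<partial>lborel)"
    using assms(4) integral_abs_bound[of lborel "\<lambda>x. indicator {\<alpha>..\<beta>} x * d x"] V[OF assms(3)] by linarith
  then have "ennreal c \<le> ennreal (\<integral>x. \<bar>indicator {\<alpha>..\<beta>} x * d x\<bar> \<partial>lborel)" by (rule ennreal_leI)
  also have "\<dots> = (\<integral>\<^sup>+ x. ennreal \<bar>indicator {\<alpha>..\<beta>} x * d x\<bar> \<partial>lborel)"
    using i by (intro nn_integral_eq_integral[symmetric]) auto
  also have "\<dots> = (\<integral>\<^sup>+ y. indicator {\<alpha><..<\<beta>} y * ennreal \<bar>d y\<bar> \<partial>lborel)"
  proof (rule nn_integral_cong_AE)
    show "AE x in lborel. ennreal \<bar>indicator {\<alpha>..\<beta>} x * d x\<bar> = indicator {\<alpha><..<\<beta>} x * ennreal \<bar>d x\<bar>"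
      using AE_lborel_singleton[of \<alpha>] AE_lborel_singleton[of \<beta>]
      by eventually_elim (auto simp: indicator_def)
  qed
  finally show ?thesis .
qed

lemma nn_integral_half_line_const:
  assumes "c > 0" "A = {..<y} \<or> A = {y<..}"
  shows "(\<integral>\<^sup>+ x. ennreal c * indicator A (x::real) \<partial>lborel) = \<infinity>"
proof -
  have "emeasure lborel A = \<infinity>"
  proof (rule ennreal_eq_top_if_of_nat_le)
    fix n :: nat
    obtain B where B: "B \<subseteq> A" "emeasure lborel B = of_nat n"
    proof -
      have "{y - real n<..<y} \<subseteq> {..<y}" "{y<..<y + real n} \<subseteq> {y<..}" by auto
      moreover have "emeasure lborel {y - real n<..<y} = of_nat n" "emeasure lborel {y<..<y + real n} = of_nat n"
        by (simp_all add: ennreal_of_nat_eq_real_of_nat)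
      ultimately show ?thesis using assms(2) that by metis
    qed
    have "of_nat n = emeasure lborel B" using B by simp
    also have "\<dots> \<le> emeasure lborel A" using assms(2) B(1) by (intro emeasure_mono) (elim disjE; simp)+
    finally show "of_nat n \<le> emeasure lborel A" .
  qed
  moreover have "A \<in> sets lborel" using assms(2) by auto
  ultimately show ?thesis using assms(1) by (simp add: nn_integral_cmult_indicator ennreal_mult_top)
qed

text \<open>Otherwise \<open>V\<close> would be at least \<open>a\<close> on a whole half-line, and
  its integral would be infinite.\<close>

lemma small_values_both_sides:
  fixes V :: "real \<Rightarrow> real"
  assumes int: "(\<integral>\<^sup>+ y. ennreal (V y) \<partial>lborel) < \<infinity>" and "a > 0"
  shows "\<exists>y<y0. V y < a" "\<exists>y>y0. V y < a"
proof -
  have *: "\<exists>y\<in>A. V y < a" if A: "A = {..<y0} \<or> A = {y0<..}" for A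
  proof (rule ccontr)
    assume "\<not> ?thesis"
    then have "(\<integral>\<^sup>+ x. ennreal a * indicator A x \<partial>lborel) \<le> (\<integral>\<^sup>+ y. ennreal (V y) \<partial>lborel)"
      by (intro nn_integral_mono) (auto simp: indicator_def not_less intro: ennreal_leI)
    then show False using nn_integral_half_line_const[OF \<open>a > 0\<close> A] int by simp
  qed
  show "\<exists>y<y0. V y < a" "\<exists>y>y0. V y < a" using *[of "{..<y0}"] *[of "{y0<..}"] by auto
qed

text \<open>Finite mass brings \<open>V\<close> below \<open>a\<close> on either side of
  \<open>y0\<close>, so there is an upcrossing to the left and a downcrossing to the right; they are
  disjoint, whence the factor 2. The band is half-open so that consecutive bands tile the
  heights.\<close>

lemma band_variation:
  fixes d V :: "real \<Rightarrow> real"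
  assumes d: "\<And>a b. set_integrable lborel {a..b} d"
    and V: "\<And>a b. a \<le> b \<Longrightarrow> V b - V a = (\<integral>x. indicator {a..b} x * d x \<partial>lborel)"
    and int: "(\<integral>\<^sup>+ y. ennreal (V y) \<partial>lborel) < \<infinity>"
    and "0 < a" "a < b" "b \<le> V y0"
  shows "2 * ennreal (b - a) \<le> (\<integral>\<^sup>+ y. indicator {a..<b} (V y) * ennreal \<bar>d y\<bar> \<partial>lborel)"
proof -
  note cont = isCont_primitive[OF d V]
  have [measurable]: "d \<in> borel_measurable borel" by (rule borel_measurable_locally_integrable[OF d])
  obtain y1 y2 where y: "y1 < y0" "V y1 < a" "y0 < y2" "V y2 < a"
    using small_values_both_sides[OF int \<open>0 < a\<close>, of y0] by blast
  obtain \<alpha> \<beta> where 1: "\<alpha> < \<beta>" "\<beta> \<le> y0" "V \<alpha> \<le> a" "b \<le> V \<beta>" "\<forall>y. \<alpha> < y \<longrightarrow> y < \<beta> \<longrightarrow> a < V y \<and> V y < b"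
    using upcrossing_exists[OF cont y(1), of a b] y assms by auto
  obtain \<gamma> \<delta> where 2: "y0 \<le> \<gamma>" "\<gamma> < \<delta>" "V \<delta> \<le> a" "b \<le> V \<gamma>" "\<forall>y. \<gamma> < y \<longrightarrow> y < \<delta> \<longrightarrow> a < V y \<and> V y < b"
    using downcrossing_exists[OF cont y(3), of a b] y assms by auto
  have "2 * ennreal (b - a) = ennreal (b - a) + ennreal (b - a)" by (simp add: mult_2)
  also have "\<dots> \<le> (\<integral>\<^sup>+ y. indicator {\<alpha><..<\<beta>} y * ennreal \<bar>d y\<bar> \<partial>lborel) + (\<integral>\<^sup>+ y. indicator {\<gamma><..<\<delta>} y * ennreal \<bar>d y\<bar> \<partial>lborel)"
    using 1 2 \<open>a < b\<close> by (intro add_mono crossing_variation[OF d V]) auto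
  also have "\<dots> = (\<integral>\<^sup>+ y. indicator {\<alpha><..<\<beta>} y * ennreal \<bar>d y\<bar> + indicator {\<gamma><..<\<delta>} y * ennreal \<bar>d y\<bar> \<partial>lborel)"
    by (intro nn_integral_add[symmetric]) measurable
  also have "\<dots> \<le> (\<integral>\<^sup>+ y. indicator {a..<b} (V y) * ennreal \<bar>d y\<bar> \<partial>lborel)"
  proof (intro nn_integral_mono)
    fix y
    have "\<alpha> < y \<and> y < \<beta> \<Longrightarrow> a < V y \<and> V y < b" "\<gamma> < y \<and> y < \<delta> \<Longrightarrow> a < V y \<and> V y < b" "\<not> ((\<alpha> < y \<and> y < \<beta>) \<and> (\<gamma> < y \<and> y < \<delta>))"
      using 1 2 by auto
    then show "indicator {\<alpha><..<\<beta>} y * ennreal \<bar>d y\<bar> + indicator {\<gamma><..<\<delta>} y * ennreal \<bar>d y\<bar> \<le> indicator {a..<b} (V y) * ennreal \<bar>d y\<bar>"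
      by (auto simp: indicator_def)
  qed
  finally show ?thesis .
qed

text \<open>From the right, lower semicontinuity bounds the values from below and monotonicity
  bounds them from above.\<close>

lemma tendsto_from_right:
  assumes z: "nonincr_on_nonneg z" "lsc_on_nonneg z" and "0 \<le> x" "\<And>n. x \<le> X n" "X \<longlonglongrightarrow> x"
  shows "(\<lambda>n. z (X n)) \<longlonglongrightarrow> z x"
proof (rule order_tendstoI)
  fix a assume "a < z x"
  then obtain \<delta> where \<delta>: "\<delta> > 0" "\<And>y. x \<le> y \<Longrightarrow> y < x + \<delta> \<Longrightarrow> a < z y"
    using lsc_right_nbhd[OF z(2) \<open>0 \<le> x\<close>] by blast
  have "\<forall>\<^sub>F n in sequentially. X n < x + \<delta>" using order_tendstoD(2)[OF assms(5)] \<delta>(1) by simp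
  then show "\<forall>\<^sub>F n in sequentially. a < z (X n)" by eventually_elim (auto intro: \<delta>(2) assms)
next
  fix a assume "z x < a"
  then show "\<forall>\<^sub>F n in sequentially. z (X n) < a"
    using z(1) assms(3,4) unfolding nonincr_on_nonneg_def by (intro always_eventually allI) (metis order.strict_trans1)
qed


text \<open>One inequality of the coarea formula, obtained from the crossing count. On each dyadic
  band the weight is replaced by a constant below it, using the left endpoint for the factor
  \<open>x\<close> and the right endpoint for the nonincreasing \<open>z\<close>;
  \<open>band_variation\<close> is applied band by band, and Fatou passes to the limit.\<close>

lemma weighted_variation_lower_bound:
  fixes d V :: "real \<Rightarrow> real"
  assumes z: "nonincr_on_nonneg z" "lsc_on_nonneg z" and zfin: "\<And>x. 0 < x \<Longrightarrow> z x < \<infinity>"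
    and d: "\<And>a b. set_integrable lborel {a..b} d"
    and V: "\<And>a b. a \<le> b \<Longrightarrow> V b - V a = (\<integral>x. indicator {a..b} x * d x \<partial>lborel)"
    and V0: "\<And>y. 0 \<le> V y" and int: "(\<integral>\<^sup>+ y. ennreal (V y) \<partial>lborel) < \<infinity>"
    and s: "\<And>x. 0 < x \<Longrightarrow> ennreal s < z x \<Longrightarrow> \<exists>y. x \<le> V y"
    and "0 \<le> s"
  shows "(\<integral>\<^sup>+ x. optimal_density z s x \<partial>lborel) \<le>
         (\<integral>\<^sup>+ y. ennreal (sqrt (2 * V y * max 0 (enn2real (z (V y)) - s))) * ennreal \<bar>d y\<bar> \<partial>lborel)"
proof -
  have contV: "continuous_on S V" for S using isCont_primitive[OF d V] by (simp add: continuous_at_imp_continuous_on)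
  have [measurable]: "V \<in> borel_measurable borel" by (intro borel_measurable_continuous_onI contV)
  have [measurable]: "d \<in> borel_measurable borel" by (rule borel_measurable_locally_integrable[OF d])
  define h where "h x = ennreal (sqrt (2 * x * max 0 (enn2real (z x) - s)))" for x
  \<comment> \<open>dyadic step functions below \<open>h\<close>; right continuity of \<open>z\<close> makes them converge to \<open>h\<close>\<close>
  define c where "c n k = ennreal (sqrt (2 * (real k / 2^n) * max 0 (enn2real (z (real (Suc k) / 2^n)) - s)))" for n k :: nat
  define I where "I n k = {real k / 2^n..<real (Suc k) / 2^n}" for n k :: nat
  define H where "H n x = (\<Sum>k. c n k * indicator (I n k) x)" for n x
  \<comment> \<open>Each nonnegative height lies in exactly one band, so the series
    \<open>H n x\<close> has a single nonzero term.\<close>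
  have I: "x \<in> I n k \<longleftrightarrow> k = nat \<lfloor>x * 2^n\<rfloor>" if "0 \<le> x" for x n k
    using that unfolding I_def
    by (auto simp: field_simps floor_eq_iff nat_eq_iff2 eq_nat_nat_iff)
  have H: "H n x = c n (nat \<lfloor>x * 2^n\<rfloor>)" if "0 \<le> x" for n x
  proof -
    have "H n x = (\<Sum>k\<in>{nat \<lfloor>x * 2^n\<rfloor>}. c n k * indicator (I n k) x)"
      unfolding H_def by (rule suminf_finite) (auto simp: I[OF that])
    then show ?thesis using I[OF that, of n "nat \<lfloor>x * 2^n\<rfloor>"] by simp
  qed
  have bounds: "real (nat \<lfloor>x * 2^n\<rfloor>) / 2^n \<le> x" "x \<le> real (Suc (nat \<lfloor>x * 2^n\<rfloor>)) / 2^n" if "0 \<le> x" for x n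
    using I[OF that, of n "nat \<lfloor>x * 2^n\<rfloor>"] by (auto simp: I_def)
  have Hh: "H n x \<le> h x" if "0 \<le> x" for n x
  proof (cases "x = 0")
    case True
    then show ?thesis using H[of 0 n] by (simp add: c_def h_def)
  next
    case False
    with that have "0 < x" by simp
    let ?k = "nat \<lfloor>x * 2^n\<rfloor>"
    have "z (real (Suc ?k) / 2^n) \<le> z x"
      using z(1) bounds(2)[OF that, of n] that unfolding nonincr_on_nonneg_def by blast
    then have "enn2real (z (real (Suc ?k) / 2^n)) \<le> enn2real (z x)"
      using zfin[OF \<open>0 < x\<close>] by (intro enn2real_mono) auto
    then show ?thesis unfolding H[OF that] c_def h_def
      using bounds(1)[OF that, of n] that by (intro ennreal_leI real_sqrt_le_mono mult_mono) auto
  qed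
  have lim: "(\<lambda>n. H n x) \<longlonglongrightarrow> h x" if "0 < x" for x
  proof -
    let ?k = "\<lambda>n. nat \<lfloor>x * 2^n\<rfloor>"
    have x0: "0 \<le> x" using that by simp
    have p: "(\<lambda>n. 1 / 2^n :: real) \<longlonglongrightarrow> 0"
      using LIMSEQ_power_zero[of "1/2::real"] by (simp add: power_divide)
    have 1: "(\<lambda>n. real (?k n) / 2^n) \<longlonglongrightarrow> x"
    proof (rule tendsto_sandwich)
      show "(\<lambda>n. x - 1 / 2^n) \<longlonglongrightarrow> x" using tendsto_diff[OF tendsto_const[of x] p] by simp
      show "(\<lambda>n. x) \<longlonglongrightarrow> x" by simp
      show "\<forall>\<^sub>F n in sequentially. x - 1 / 2 ^ n \<le> real (?k n) / 2 ^ n"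
        using bounds(2)[OF x0] by (intro always_eventually allI) (simp add: add_divide_distrib algebra_simps)
      show "\<forall>\<^sub>F n in sequentially. real (?k n) / 2 ^ n \<le> x"
        using bounds(1)[OF x0] by simp
    qed
    have 2: "(\<lambda>n. real (Suc (?k n)) / 2^n) \<longlonglongrightarrow> x"
      using tendsto_add[OF p 1] by (simp add: add_divide_distrib)
    have "(\<lambda>n. z (real (Suc (?k n)) / 2^n)) \<longlonglongrightarrow> z x"
      by (rule tendsto_from_right[OF z x0 bounds(2)[OF x0] 2])
    then have 3: "(\<lambda>n. enn2real (z (real (Suc (?k n)) / 2^n))) \<longlonglongrightarrow> enn2real (z x)"
      using zfin[OF that] by (intro tendsto_enn2real) auto
    show ?thesis
      unfolding H[OF x0] c_def h_def by (intro tendsto_intros 1 3)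
  qed
  have [measurable]: "I n k \<in> sets borel" for n k by (simp add: I_def)
  have [measurable]: "H n \<in> borel_measurable borel" for n unfolding H_def by measurable
  have step: "2 * (\<integral>\<^sup>+ x. H n x \<partial>lborel) \<le> (\<integral>\<^sup>+ y. h (V y) * ennreal \<bar>d y\<bar> \<partial>lborel)" for n
  proof -
    have "2 * (\<integral>\<^sup>+ x. H n x \<partial>lborel) = 2 * (\<Sum>k. \<integral>\<^sup>+ x. c n k * indicator (I n k) x \<partial>lborel)"
      unfolding H_def by (subst nn_integral_suminf) auto
    also have "\<dots> = (\<Sum>k. 2 * (\<integral>\<^sup>+ x. c n k * indicator (I n k) x \<partial>lborel))" by simp
    also have "\<dots> \<le> (\<Sum>k. \<integral>\<^sup>+ y. c n k * indicator (I n k) (V y) * ennreal \<bar>d y\<bar> \<partial>lborel)"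
    proof (rule suminf_le)
      fix k
      show "2 * (\<integral>\<^sup>+ x. c n k * indicator (I n k) x \<partial>lborel) \<le> (\<integral>\<^sup>+ y. c n k * indicator (I n k) (V y) * ennreal \<bar>d y\<bar> \<partial>lborel)"
      \<comment> \<open>In these bands the coefficient vanishes: for \<open>k = 0\<close> through
        the factor \<open>x\<close>, otherwise through the truncation at \<open>s\<close>. In every
        other band \<open>z\<close> still exceeds \<open>s\<close> at the upper end, so by
        assumption \<open>V\<close> reaches that end.\<close>
      proof (cases "k = 0 \<or> z (real (Suc k) / 2^n) \<le> ennreal s")
        case True
        then have "c n k = 0"
        proof
          assume "z (real (Suc k) / 2^n) \<le> ennreal s"
          then have "enn2real (z (real (Suc k) / 2^n)) \<le> s" using \<open>0 \<le> s\<close> by (metis enn2real_ennreal enn2real_mono ennreal_less_top)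
          then show ?thesis by (simp add: c_def)
        qed (simp add: c_def)
        then show ?thesis by simp
      next
        case False
        then obtain y0 where y0: "real (Suc k) / 2^n \<le> V y0" using s[of "real (Suc k) / 2^n"] by (auto simp: not_le)
        have "2 * ennreal (real (Suc k) / 2^n - real k / 2^n) \<le> (\<integral>\<^sup>+ y. indicator (I n k) (V y) * ennreal \<bar>d y\<bar> \<partial>lborel)"
          unfolding I_def by (rule band_variation[OF d V int _ _ y0]) (use False in \<open>auto simp: divide_strict_right_mono\<close>)
        moreover have "emeasure lborel (I n k) = ennreal (real (Suc k) / 2^n - real k / 2^n)"
          by (simp add: I_def divide_right_mono)
        ultimately have "c n k * (2 * emeasure lborel (I n k)) \<le> c n k * (\<integral>\<^sup>+ y. indicator (I n k) (V y) * ennreal \<bar>d y\<bar> \<partial>lborel)"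
          by (intro mult_left_mono) auto
        then show ?thesis by (simp add: nn_integral_cmult nn_integral_cmult_indicator mult_ac)
      qed
    qed auto
    also have "\<dots> = (\<integral>\<^sup>+ y. (\<Sum>k. c n k * indicator (I n k) (V y) * ennreal \<bar>d y\<bar>) \<partial>lborel)"
      by (subst nn_integral_suminf) auto
    also have "\<dots> = (\<integral>\<^sup>+ y. H n (V y) * ennreal \<bar>d y\<bar> \<partial>lborel)"
      by (simp add: H_def)
    also have "\<dots> \<le> (\<integral>\<^sup>+ y. h (V y) * ennreal \<bar>d y\<bar> \<partial>lborel)"
      by (intro nn_integral_mono mult_right_mono Hh V0) auto
    finally show ?thesis .
  qed
  have "(\<integral>\<^sup>+ x. optimal_density z s x \<partial>lborel) \<le> (\<integral>\<^sup>+ x. liminf (\<lambda>n. 2 * H n x) \<partial>lborel)"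
  proof (intro nn_integral_mono)
    fix x :: real
    show "optimal_density z s x \<le> liminf (\<lambda>n. 2 * H n x)"
    proof (cases "0 < x")
      case True
      have "(\<lambda>n. 2 * H n x) \<longlonglongrightarrow> 2 * h x" using lim[OF True] by (intro tendsto_mult_ennreal) auto
      then have "liminf (\<lambda>n. 2 * H n x) = 2 * h x" by (intro lim_imp_Liminf) auto
      also have "2 * h x = optimal_density z s x"
        using True zfin[OF True] unfolding h_def optimal_density_def
        by (auto simp: ennreal_mult)
      finally show ?thesis by simp
    qed (simp add: optimal_density_def)
  qed
  also have "\<dots> \<le> liminf (\<lambda>n. \<integral>\<^sup>+ x. 2 * H n x \<partial>lborel)"
    by (rule nn_integral_liminf) measurable
  also have "\<dots> \<le> limsup (\<lambda>n. \<integral>\<^sup>+ x. 2 * H n x \<partial>lborel)" by (simp add: Liminf_le_Limsup)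
  also have "\<dots> \<le> (\<integral>\<^sup>+ y. h (V y) * ennreal \<bar>d y\<bar> \<partial>lborel)"
    using step by (intro Limsup_bounded always_eventually allI) (simp add: nn_integral_cmult)
  finally show ?thesis unfolding h_def .
qed

lemma emeasure_open_pos:
  fixes S :: "real set"
  assumes "open S" "S \<noteq> {}"
  shows "emeasure lborel S > 0"
proof (rule ccontr)
  assume "\<not> ?thesis"
  then have "S \<in> null_sets lborel" using assms by (auto simp: null_sets_def)
  then have "negligible S" by (simp add: negligible_iff_null_sets null_sets_completionI)
  then show False using open_not_negligible[OF assms] by simp
qed

text \<open>Completing the square in \<open>\<bar>d\<bar> - sqrt (2 * x * (u - s))\<close>. The case
  of equality is the differential equation behind the profiles of the upper bound.\<close>

lemma AM_GM_energy:
  fixes d u x s :: real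
  assumes "0 \<le> x" "s \<le> u"
  shows "sqrt (2 * x * max 0 (u - s)) * \<bar>d\<bar> + s * x \<le> 1/2 * d\<^sup>2 + u * x"
proof -
  have "2 * x * (u - s) = (sqrt (2 * x * (u - s)))\<^sup>2" using assms by simp
  moreover have "0 \<le> (\<bar>d\<bar> - sqrt (2 * x * (u - s)))\<^sup>2" by simp
  ultimately show ?thesis using assms by (simp add: power2_diff algebra_simps)
qed

lemma energy_lower_bound:
  assumes z: "nonincr_on_nonneg z" "lsc_on_nonneg z" and "0 < w"
    and \<psi>0: "\<And>y. 0 \<le> \<psi> y" and \<psi>w: "has_bochner_integral lborel \<psi> w" and wd: "weak_deriv \<psi> d"
  shows "\<exists>s\<ge>0. (\<integral>\<^sup>+ x. optimal_density z s x \<partial>lborel) + ennreal (s * w) \<le>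
           (\<integral>\<^sup>+ y. ennreal (1/2 * (d y)\<^sup>2) + cfun z \<bar>\<psi> y\<bar> \<partial>lborel)" (is "\<exists>s\<ge>0. _ \<le> ?E")
proof (cases "?E = \<infinity>")
  case True
  then show ?thesis by (intro exI[of _ 0]) simp
next
  case False
  obtain V where VAE: "AE x in lborel. \<psi> x = V x" and cont: "\<And>x. isCont V x"
    and V: "\<And>a b. a \<le> b \<Longrightarrow> V b - V a = (\<integral>x. indicator {a..b} x * d x \<partial>lborel)"
    using weak_deriv_continuous_representative[OF wd] by blast
  have d: "\<And>a b. set_integrable lborel {a..b} d" using wd by (auto simp: weak_deriv_def)
  have contV: "continuous_on S V" for S using cont by (simp add: continuous_at_imp_continuous_on)
  have [measurable]: "V \<in> borel_measurable borel" by (intro borel_measurable_continuous_onI contV)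
  have [measurable]: "d \<in> borel_measurable borel" by (rule borel_measurable_locally_integrable[OF d])
  \<comment> \<open>A priori \<open>V\<close> is nonnegative only almost everywhere, but by
    continuity a negative value would persist on a set of positive measure.\<close>
  have V0: "0 \<le> V y" for y
  proof (rule ccontr)
    assume "\<not> 0 \<le> V y"
    then have "emeasure lborel {y. V y < 0} > 0"
      by (intro emeasure_open_pos open_Collect_less contV continuous_intros) (auto simp: not_le)
    moreover have "AE x in lborel. x \<notin> {y. V y < 0}"
      using VAE by eventually_elim (metis \<psi>0 mem_Collect_eq not_le)
    then have "emeasure lborel {y. V y < 0} = 0" by (subst (asm) AE_iff_measurable[OF _ refl]) auto
    ultimately show False by simp
  qed
  have mass: "(\<integral>\<^sup>+ y. ennreal (V y) \<partial>lborel) = ennreal w"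
  proof -
    have "(\<integral>\<^sup>+ y. ennreal (V y) \<partial>lborel) = (\<integral>\<^sup>+ y. ennreal (\<psi> y) \<partial>lborel)"
      by (intro nn_integral_cong_AE) (use VAE in \<open>eventually_elim, simp\<close>)
    also have "\<dots> = ennreal w"
      using \<psi>w \<psi>0 by (subst nn_integral_eq_integral) (auto simp: has_bochner_integral_iff)
    finally show ?thesis .
  qed
  then have int: "(\<integral>\<^sup>+ y. ennreal (V y) \<partial>lborel) < \<infinity>" by simp
  have E: "?E = (\<integral>\<^sup>+ y. ennreal (1/2 * (d y)\<^sup>2) + cfun z (V y) \<partial>lborel)"
    by (intro nn_integral_cong_AE) (use VAE in \<open>eventually_elim, simp add: V0\<close>)
  obtain y0 where y0: "V y0 > 0"
  proof (rule ccontr)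
    assume "\<not> thesis"
    then have "V y = 0" for y using that V0[of y] by (auto simp: order_less_le)
    then show False using mass \<open>0 < w\<close> by simp
  qed
  \<comment> \<open>If \<open>z x\<close> were infinite, then so would be \<open>z\<close> at all
    smaller heights. By continuity \<open>V\<close> takes small positive values on a nonempty open
    set, and the energy would be infinite.\<close>
  have zfin: "z x < \<infinity>" if "0 < x" for x
  proof (rule ccontr)
    assume "\<not> z x < \<infinity>"
    then have zx: "z x = \<infinity>" by (simp add: less_top[symmetric])
    define m where "m = min x (V y0)"
    have "m > 0" using that y0 by (simp add: m_def)
    obtain y1 where "y1 < y0" "V y1 < m / 2" using small_values_both_sides(1)[OF int, of "m/2" y0] \<open>m > 0\<close> by auto
    moreover have "m / 2 \<le> V y0" using \<open>m > 0\<close> by (simp add: m_def min_def split: if_splits)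
    ultimately obtain y2 where "V y2 = m / 2"
      using IVT'[of V y1 "m/2" y0] contV by auto
    then have "emeasure lborel {y. 0 < V y \<and> V y < m} > 0"
      using \<open>m > 0\<close> by (intro emeasure_open_pos open_Collect_conj open_Collect_less contV continuous_intros) auto
    then have "\<infinity> = (\<integral>\<^sup>+ y. \<infinity> * indicator {y. 0 < V y \<and> V y < m} y \<partial>lborel)"
      by (subst nn_integral_cmult_indicator) (auto simp: ennreal_top_mult)
    also have "\<dots> \<le> ?E" unfolding E
    proof (intro nn_integral_mono)
      fix y
      have "cfun z (V y) = \<infinity>" if "0 < V y" "V y < m"
      proof -
        have "z x \<le> z (V y)" using z(1) that unfolding nonincr_on_nonneg_def m_def by auto
        then show ?thesis using zx that by (simp add: cfun_def top_unique ennreal_top_mult)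
      qed
      then show "\<infinity> * indicator {y. 0 < V y \<and> V y < m} y \<le> ennreal (1/2 * (d y)\<^sup>2) + cfun z (V y)"
        by (auto simp: indicator_def)
    qed
    finally show False using \<open>?E \<noteq> \<infinity>\<close> by (simp add: top_unique)
  qed
  define S where "S = (INF y. z (V y))"
  have "S \<le> z (V y0)" unfolding S_def by (rule INF_lower) simp
  then have "S < \<infinity>" using zfin[OF y0] by (rule order.strict_trans1)
  then obtain s where s: "0 \<le> s" "S = ennreal s" by (cases S) auto
  have s_le: "ennreal s \<le> z (V y)" for y unfolding s(2)[symmetric] S_def by (rule INF_lower) simp
  \<comment> \<open>If \<open>V\<close> stayed below \<open>x\<close>, monotonicity would make
    \<open>z x\<close> a lower bound of \<open>z\<close> along \<open>V\<close>, hence at most the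
    infimum \<open>S\<close>.\<close>
  have s_less: "\<exists>y. x \<le> V y" if "0 < x" "ennreal s < z x" for x
  proof (rule ccontr)
    assume "\<not> ?thesis"
    then have "z x \<le> z (V y)" for y
      using z(1) V0[of y] unfolding nonincr_on_nonneg_def by (meson not_le less_imp_le)
    then have "z x \<le> S" unfolding S_def by (intro INF_greatest)
    then show False using that s by simp
  qed
  have sw: "ennreal (s * w) = (\<integral>\<^sup>+ y. ennreal (s * V y) \<partial>lborel)"
    using mass s(1) V0 \<open>0 < w\<close> by (simp add: ennreal_mult nn_integral_cmult)
  have "(\<integral>\<^sup>+ x. optimal_density z s x \<partial>lborel) + ennreal (s * w) \<le>
    (\<integral>\<^sup>+ y. ennreal (sqrt (2 * V y * max 0 (enn2real (z (V y)) - s))) * ennreal \<bar>d y\<bar> \<partial>lborel) + (\<integral>\<^sup>+ y. ennreal (s * V y) \<partial>lborel)"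
    unfolding sw by (intro add_right_mono weighted_variation_lower_bound[OF z zfin d V V0 int s_less s(1)])
  also have "\<dots>
     = (\<integral>\<^sup>+ y. ennreal (sqrt (2 * V y * max 0 (enn2real (z (V y)) - s))) * ennreal \<bar>d y\<bar> + ennreal (s * V y) \<partial>lborel)"
  proof (rule nn_integral_add[symmetric])
    note [measurable] = borel_measurable_nonincr[OF z(1)]
    have "(\<lambda>y. ennreal (sqrt (2 * V y * max 0 (enn2real (z (max 0 (V y))) - s))) * ennreal \<bar>d y\<bar>) \<in> borel_measurable lborel"
      by measurable
    then show "(\<lambda>y. ennreal (sqrt (2 * V y * max 0 (enn2real (z (V y)) - s))) * ennreal \<bar>d y\<bar>) \<in> borel_measurable lborel"
      using V0 by (simp add: max_absorb2)
  qed measurable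
  also have "\<dots> \<le> ?E" unfolding E
  proof (intro nn_integral_mono)
    fix y
    show "ennreal (sqrt (2 * V y * max 0 (enn2real (z (V y)) - s))) * ennreal \<bar>d y\<bar> + ennreal (s * V y) \<le> ennreal (1/2 * (d y)\<^sup>2) + cfun z (V y)"
    proof (cases "V y = 0")
      case False
      then have "0 < V y" using V0[of y] by simp
      then obtain u where u: "z (V y) = ennreal u" "0 \<le> u" using zfin[of "V y"] by (cases "z (V y)") auto
      have "s \<le> u" using s_le[of y] u s(1) by simp
      from AM_GM_energy[OF V0[of y] this, of "d y"] have
        "ennreal (sqrt (2 * V y * max 0 (u - s)) * \<bar>d y\<bar> + s * V y) \<le> ennreal (1/2 * (d y)\<^sup>2 + u * V y)"
        by (rule ennreal_leI)
      then show ?thesis using u s(1) V0[of y] False by (simp add: cfun_def ennreal_mult ennreal_plus)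
    qed simp
  qed
  finally show ?thesis using s(1) by blast
qed

section \<open>Upper bound for the minimal energy\<close>

text \<open>The image under \<open>Y\<close> of the measure with density \<open>r\<close> agrees
  with Lebesgue measure on intervals, hence everywhere. Only increments of \<open>Y\<close> are
  used, which suits a merely Borel \<open>r\<close>.\<close>

lemma nn_integral_substitution_primitive:
  fixes r Y :: "real \<Rightarrow> real" and f :: "real \<Rightarrow> ennreal"
  assumes [measurable]: "r \<in> borel_measurable borel" "f \<in> borel_measurable borel" and r: "\<And>x. 0 \<le> r x"
    and Y: "strict_mono Y" "surj Y" "\<And>x. isCont Y x"
    and rY: "\<And>a b. a \<le> b \<Longrightarrow> (\<integral>\<^sup>+ x. indicator {a..b} x * ennreal (r x) \<partial>lborel) = ennreal (Y b - Y a)"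
  shows "(\<integral>\<^sup>+ x. f (Y x) * ennreal (r x) \<partial>lborel) = (\<integral>\<^sup>+ x. f x \<partial>lborel)"
proof -
  have [measurable]: "Y \<in> borel_measurable borel"
    using Y(3) by (intro borel_measurable_continuous_onI continuous_at_imp_continuous_on) auto
  have "lborel = distr (density lborel (\<lambda>x. ennreal (r x))) borel Y"
  proof (rule lborel_eqI)
    fix l u :: real assume "\<And>b. b \<in> Basis \<Longrightarrow> l \<bullet> b \<le> u \<bullet> b"
    then have lu: "l \<le> u" by simp
    obtain a b where ab: "l = Y a" "u = Y b" using Y(2) by (metis surjD)
    then have "a \<le> b" using lu Y(1) by (simp add: strict_mono_less_eq)
    have vim: "Y -` box l u = {a<..<b}" using Y(1) by (auto simp: ab box_real strict_mono_less)
    have "emeasure (distr (density lborel (\<lambda>x. ennreal (r x))) borel Y) (box l u) = emeasure (density lborel (\<lambda>x. ennreal (r x))) (Y -` box l u)"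
      by (subst emeasure_distr) auto
    also have "\<dots> = (\<integral>\<^sup>+ x. ennreal (r x) * indicator {a<..<b} x \<partial>lborel)"
      unfolding vim by (subst emeasure_density) auto
    also have "\<dots> = (\<integral>\<^sup>+ x. indicator {a..b} x * ennreal (r x) \<partial>lborel)"
    proof (rule nn_integral_cong_AE)
      show "AE x in lborel. ennreal (r x) * indicator {a<..<b} x = indicator {a..b} x * ennreal (r x)"
        using AE_lborel_singleton[of a] AE_lborel_singleton[of b] by eventually_elim (auto simp: indicator_def)
    qed
    also have "\<dots> = ennreal (u - l)" using rY[OF \<open>a \<le> b\<close>] ab by simp
    finally show "emeasure (distr (density lborel (\<lambda>x. ennreal (r x))) borel Y) (box l u) = (\<Prod>b\<in>Basis. (u - l) \<bullet> b)"
      by simp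
  qed simp
  then have "(\<integral>\<^sup>+ x. f x \<partial>lborel) = (\<integral>\<^sup>+ x. f x \<partial>distr (density lborel (\<lambda>x. ennreal (r x))) borel Y)" by simp
  also have "\<dots> = (\<integral>\<^sup>+ x. f (Y x) \<partial>density lborel (\<lambda>x. ennreal (r x)))"
    by (rule nn_integral_distr) auto
  also have "\<dots> = (\<integral>\<^sup>+ x. ennreal (r x) * f (Y x) \<partial>lborel)"
    by (rule nn_integral_density) auto
  finally show ?thesis by (simp add: mult.commute)
qed

text \<open>The value 1 of \<open>r\<close> outside \<open>(0, H)\<close> makes the primitive affine
  with slope 1 there, which gives surjectivity onto the line; positivity of \<open>r\<close> gives
  strictness.\<close>

lemma increasing_primitive_homeo:
  fixes r :: "real \<Rightarrow> real"
  assumes [measurable]: "r \<in> borel_measurable borel" and r: "\<And>x. 0 < r x" "\<And>x. r x \<le> B"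
    and out: "\<And>x. x \<notin> {0<..<H} \<Longrightarrow> r x = 1" and "0 < H"
  obtains Y where "strict_mono Y" "surj Y" "\<And>x. isCont Y x" "Y 0 = 0"
    "\<And>a b. a \<le> b \<Longrightarrow> (\<integral>\<^sup>+ x. indicator {a..b} x * ennreal (r x) \<partial>lborel) = ennreal (Y b - Y a)"
proof -
  have ri: "set_integrable lborel {a..b} r" for a b
    unfolding set_integrable_def
  proof (rule Bochner_Integration.integrable_bound)
    show "integrable lborel (\<lambda>x. indicator {a..b} x * B)"
      by (simp add: integrable_indicator_iff emeasure_lborel_Icc_eq)
    have "norm (r x) \<le> norm B" for x using r(1)[of x] r(2)[of x] by simp
    then show "AE x in lborel. norm (indicator {a..b} x *\<^sub>R r x) \<le> norm (indicator {a..b} x * B)"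
      by (auto simp: indicator_def)
  qed measurable
  obtain V where V: "\<And>a b. a \<le> b \<Longrightarrow> V b - V a = (\<integral>x. indicator {a..b} x * r x \<partial>lborel)"
    using primitive_exists[OF ri] by blast
  have nn: "(\<integral>\<^sup>+ x. indicator {a..b} x * ennreal (r x) \<partial>lborel) = ennreal (V b - V a)" if "a \<le> b" for a b
  proof -
    have "(\<integral>\<^sup>+ x. indicator {a..b} x * ennreal (r x) \<partial>lborel) = (\<integral>\<^sup>+ x. ennreal (indicator {a..b} x * r x) \<partial>lborel)"
      by (intro nn_integral_cong) (auto simp: indicator_def)
    also have "\<dots> = ennreal (V b - V a)" unfolding V[OF that]
      using ri[of a b] r(1) by (intro nn_integral_eq_integral) (auto simp: set_integrable_def indicator_def less_imp_le)
    finally show ?thesis .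
  qed
  have mono: "V a < V b" if "a < b" for a b
  proof -
    have "(\<integral>x. indicator {a..b} x * r x \<partial>lborel) \<noteq> 0"
    proof
      assume "(\<integral>x. indicator {a..b} x * r x \<partial>lborel) = 0"
      then have "AE x in lborel. indicator {a..b} x * r x = 0"
        using ri[of a b] r(1) by (subst (asm) integral_nonneg_eq_0_iff_AE) (auto simp: set_integrable_def less_imp_le)
      then have "AE x in lborel. x \<notin> {a..b}"
        by eventually_elim (use r(1) in \<open>auto simp: indicator_def less_le split: if_splits\<close>)
      then have "emeasure lborel {a..b} = 0" by (subst (asm) AE_iff_measurable[of "{a..b}"]) auto
      then show False using that by simp
    qed
    moreover have "0 \<le> (\<integral>x. indicator {a..b} x * r x \<partial>lborel)" using r(1) by (intro integral_nonneg_AE) (auto simp: less_imp_le)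
    ultimately show ?thesis using V[of a b] that by simp
  qed
  have cont: "isCont V x" for x by (rule isCont_primitive[OF ri V])
  have left: "V x = V 0 + x" if "x \<le> 0" for x
  proof -
    have "V 0 - V x = (\<integral>y. indicator {x..0} y \<partial>lborel)"
      unfolding V[OF that] using out by (intro Bochner_Integration.integral_cong) (auto simp: indicator_def)
    then show ?thesis using that by simp
  qed
  have right: "V x = V H + (x - H)" if "H \<le> x" for x
  proof -
    have "V x - V H = (\<integral>y. indicator {H..x} y \<partial>lborel)"
      unfolding V[OF that] using out by (intro Bochner_Integration.integral_cong) (auto simp: indicator_def)
    then show ?thesis using that by simp
  qed
  show ?thesis
  proof (rule that[of "\<lambda>x. V x - V 0"])
    show "strict_mono (\<lambda>x. V x - V 0)" using mono by (auto simp: strict_mono_def)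
    show "isCont (\<lambda>x. V x - V 0) x" for x by (intro continuous_intros cont)
    have "\<exists>x. V x - V 0 = y" for y
    proof -
      consider "y \<le> 0" | "V H - V 0 \<le> y" | "0 \<le> y" "y \<le> V H - V 0" by linarith
      then show ?thesis
      proof cases
        case 1 then show ?thesis using left[of y] by (intro exI[of _ y]) simp
      next
        case 2 then show ?thesis using right[of "H + (y - (V H - V 0))"] by (intro exI[of _ "H + (y - (V H - V 0))"]) simp
      next
        case 3
        have "\<exists>x\<ge>0. x \<le> H \<and> V x = y + V 0"
          using 3 \<open>0 < H\<close> cont by (intro IVT') (auto intro: continuous_at_imp_continuous_on)
        then obtain x where "V x = y + V 0" by blast
        then show ?thesis by (intro exI[of _ x]) simp
      qed
    qed
    then show "surj (\<lambda>x. V x - V 0)" by (metis surjI)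
  qed (use nn in auto)
qed

text \<open>The slope \<open>p\<close> is prescribed as a function of height. Integrating
  \<open>1 / p\<close> gives the position as a function of height; its inverse is the rising flank,
  and reflection adds the falling one. Stating the formula for general \<open>F\<close> yields mass
  and energy at once; \<open>F 0 0 = 0\<close> discards the part of the line outside the
  profile.\<close>

lemma symmetric_profile:
  fixes p :: "real \<Rightarrow> real"
  assumes [measurable]: "p \<in> borel_measurable borel" and "0 < H" "0 < \<eta>"
    and p: "\<And>x. 0 < x \<Longrightarrow> x < H \<Longrightarrow> \<eta> \<le> p x"
  obtains \<psi> d where "weak_deriv \<psi> d" "\<And>y. 0 \<le> \<psi> y" "\<psi> \<in> borel_measurable borel"
    "\<And>F :: real \<Rightarrow> real \<Rightarrow> ennreal. (\<lambda>w. F (fst w) (snd w)) \<in> borel_measurable (borel \<Otimes>\<^sub>M borel) \<Longrightarrow> F 0 0 = 0 \<Longrightarrow>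
      (\<integral>\<^sup>+ y. F (\<psi> y) \<bar>d y\<bar> \<partial>lborel) = 2 * (\<integral>\<^sup>+ x. indicator {0<..<H} x * (F x (p x) * ennreal (1 / p x)) \<partial>lborel)"
proof -
  define r where "r x = (if 0 < x \<and> x < H then 1 / p x else 1)" for x
  have [measurable]: "r \<in> borel_measurable borel" unfolding r_def by measurable
  have ppos: "0 < p x" if "0 < x" "x < H" for x using p[OF that] \<open>0 < \<eta>\<close> by simp
  have r: "0 < r x" "r x \<le> max 1 (1 / \<eta>)" for x
    using p[of x] ppos[of x] \<open>0 < \<eta>\<close> by (auto simp: r_def max_def field_simps intro: order_trans)
  obtain Y where Y: "strict_mono Y" "surj Y" "\<And>x. isCont Y x" and Y0: "Y 0 = 0"
    and rY: "\<And>a b. a \<le> b \<Longrightarrow> (\<integral>\<^sup>+ x. indicator {a..b} x * ennreal (r x) \<partial>lborel) = ennreal (Y b - Y a)"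
    by (rule increasing_primitive_homeo[of r "max 1 (1 / \<eta>)" H]) (use r \<open>0 < H\<close> in \<open>auto simp: r_def\<close>)
  have [measurable]: "Y \<in> borel_measurable borel"
    using Y(3) by (intro borel_measurable_continuous_onI continuous_at_imp_continuous_on) auto
  note cov = nn_integral_substitution_primitive[OF \<open>r \<in> borel_measurable borel\<close> _ less_imp_le[OF r(1)] Y rY]
  define P where "P = inv Y"
  have PY [simp]: "P (Y x) = x" for x unfolding P_def using Y(1) by (simp add: strict_mono_imp_inj_on)
  have YP [simp]: "Y (P x) = x" for x unfolding P_def using Y(2) by (rule surj_f_inv_f)
  have P_le: "P a \<le> P b \<longleftrightarrow> a \<le> b" for a b using strict_mono_less_eq[OF Y(1), of "P a" "P b"] by simp
  have P_less: "P a < P b \<longleftrightarrow> a < b" for a b using P_le[of b a] by (simp add: not_le[symmetric])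
  have Y_le: "Y a \<le> Y b \<longleftrightarrow> a \<le> b" and Y_less: "Y a < Y b \<longleftrightarrow> a < b" for a b
    using Y(1) by (simp_all add: strict_mono_less_eq strict_mono_less)
  have [measurable]: "P \<in> borel_measurable borel" by (intro borel_measurable_mono monoI) (simp add: P_le)
  define L where "L = Y H"
  have L: "0 < L" using Y_less[of 0 H] Y0 \<open>0 < H\<close> by (simp add: L_def)
  have P0: "P 0 = 0" using PY[of 0] Y0 by simp
  have PL: "P L = H" by (simp add: L_def)
  define D where "D x = (if 0 < x \<and> x < L then p (P x) else 0)" for x
  \<comment> \<open>The rising flank: 0 up to the origin, then the inverse of \<open>Y\<close>, then
    constantly \<open>H\<close> from \<open>L\<close> on.\<close>
  define A where "A x = min H (max 0 (P x))" for x
  have [measurable]: "D \<in> borel_measurable borel" "A \<in> borel_measurable borel" unfolding D_def A_def by measurable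
  have range: "0 < x \<and> x < L \<longleftrightarrow> 0 < P x \<and> P x < H" for x
    using P_less[of 0 x] P_less[of x L] P0 PL by auto
  have D0: "0 \<le> D x" for x using ppos range[of x] by (auto simp: D_def less_imp_le)
  have DY: "D (Y x) = (if 0 < x \<and> x < H then p x else 0)" for x using range[of "Y x"] by (simp add: D_def)
  have AY: "A (Y x) = min H (max 0 x)" for x by (simp add: A_def)
  have A_mono: "A a \<le> A b" if "a \<le> b" for a b using P_le[of a b] that by (auto simp: A_def)
  have AH: "A x = H" if "L \<le> x" for x using P_le[of L x] that PL \<open>0 < H\<close> by (auto simp: A_def)
  have A_bounds: "0 \<le> A x" "A x \<le> H" for x using \<open>0 < H\<close> by (auto simp: A_def)
  \<comment> \<open>After the substitution the integrand is \<open>p x * (1 / p x) = 1\<close> on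
    the heights passed, so the integral of \<open>D\<close> is the height gained. This makes
    \<open>D\<close> a weak derivative of \<open>A\<close>.\<close>
  have nnD: "(\<integral>\<^sup>+ x. ennreal (indicator {a..b} x * D x) \<partial>lborel) = ennreal (A b - A a)" if "a \<le> b" for a b
  proof -
    have "(\<integral>\<^sup>+ x. ennreal (indicator {a..b} x * D x) \<partial>lborel) = (\<integral>\<^sup>+ x. ennreal (indicator {a..b} (Y x) * D (Y x)) * ennreal (r x) \<partial>lborel)"
      by (rule cov[symmetric]) measurable
    also have "\<dots> = (\<integral>\<^sup>+ x. indicator {A a..A b} x \<partial>lborel)"
    proof (rule nn_integral_cong_AE)
      show "AE x in lborel. ennreal (indicator {a..b} (Y x) * D (Y x)) * ennreal (r x) = indicator {A a..A b} x"
        using AE_lborel_singleton[of 0] AE_lborel_singleton[of H]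
      proof eventually_elim
        fix x :: real assume x: "x \<noteq> 0" "x \<noteq> H"
        have Yab: "a \<le> Y x \<longleftrightarrow> P a \<le> x" "Y x \<le> b \<longleftrightarrow> x \<le> P b" using Y_le[of "P a" x] Y_le[of x "P b"] by auto
        show "ennreal (indicator {a..b} (Y x) * D (Y x)) * ennreal (r x) = indicator {A a..A b} x"
        proof (cases "0 < x \<and> x < H")
          case True
          have "x \<in> {A a..A b} \<longleftrightarrow> Y x \<in> {a..b}" using True Yab by (auto simp: A_def)
          moreover have "ennreal (p x) * ennreal (1 / p x) = 1"
            using True ppos[of x] by (simp add: ennreal_mult[symmetric] less_imp_le)
          ultimately show ?thesis using True by (simp add: DY r_def indicator_def)
        next
          case False
          then have "x \<notin> {A a..A b}" using x A_bounds[of a] A_bounds[of b] by auto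
          moreover have "D (Y x) = 0" using False by (auto simp: DY)
          ultimately show ?thesis by simp
        qed
      qed
    qed
    also have "\<dots> = ennreal (A b - A a)" using A_mono[OF that] by simp
    finally show ?thesis .
  qed
  have Di: "integrable lborel (\<lambda>x. indicator {a..b} x * D x)" for a b
  proof (cases "a \<le> b")
    case True
    show ?thesis using nnD[OF True] D0 by (intro integrableI_nonneg) auto
  qed simp
  have DA: "(\<integral>x. indicator {a..b} x * D x \<partial>lborel) = A b - A a" if "a \<le> b" for a b
    using nnD[OF that] D0 A_mono[OF that] by (intro integral_eq_nn_integral[THEN trans]) auto
  have D'i: "integrable lborel (\<lambda>x. indicator {a..b} x * D (2 * L - x))" for a b
  proof -
    have "integrable lborel (\<lambda>x. (\<lambda>x. indicator {2*L-b..2*L-a} x * D x) (2 * L + (-1) * x))"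
      by (intro lborel_integrable_real_affine Di) simp
    moreover have "indicator {2*L-b..2*L-a} (2 * L + (-1) * x) = (indicator {a..b} x :: real)" for x by (auto simp: indicator_def)
    ultimately show ?thesis by simp
  qed
  have D'A: "(\<integral>x. indicator {a..b} x * D (2 * L - x) \<partial>lborel) = A (2 * L - a) - A (2 * L - b)" if "a \<le> b" for a b
  proof -
    have "(\<integral>x. indicator {2*L-b..2*L-a} x * D x \<partial>lborel) = \<bar>-1\<bar> *\<^sub>R (\<integral>x. indicator {2*L-b..2*L-a} (2 * L + (-1) * x) * D (2 * L + (-1) * x) \<partial>lborel)"
      by (rule lborel_integral_real_affine) simp
    moreover have "indicator {2*L-b..2*L-a} (2 * L + (-1) * x) = (indicator {a..b} x :: real)" for x by (auto simp: indicator_def)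
    ultimately show ?thesis using DA[of "2*L-b" "2*L-a"] that by simp
  qed
  \<comment> \<open>one of the first two summands is always \<open>H\<close>: this is \<open>A\<close> followed by its mirror image\<close>
  define \<psi> where "\<psi> x = A x + A (2 * L - x) - H" for x
  define d where "d x = D x - D (2 * L - x)" for x
  have [measurable]: "\<psi> \<in> borel_measurable borel" "d \<in> borel_measurable borel" unfolding \<psi>_def d_def by measurable
  have left: "\<psi> x = A x" "\<bar>d x\<bar> = D x" if "x < L" for x
    using AH[of "2 * L - x"] D0[of x] that by (auto simp: \<psi>_def d_def D_def)
  have right: "\<psi> x = A (2 * L - x)" "\<bar>d x\<bar> = D (2 * L - x)" if "L < x" for x
    using AH[of x] D0[of "2 * L - x"] that by (auto simp: \<psi>_def d_def D_def)
  show ?thesis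
  proof (rule that[of \<psi> d])
    show "weak_deriv \<psi> d"
    proof (rule weak_deriv_primitive)
      show "set_integrable lborel {a..b} d" for a b
        using Di[of a b] D'i[of a b] by (simp add: set_integrable_def d_def right_diff_distrib)
      show "\<psi> b - \<psi> a = (\<integral>x. indicator {a..b} x * d x \<partial>lborel)" if "a \<le> b" for a b
        using Di[of a b] D'i[of a b] DA[OF that] D'A[OF that] by (simp add: \<psi>_def d_def right_diff_distrib)
    qed
    show "0 \<le> \<psi> y" for y
    proof (cases "y < L")
      case True then show ?thesis using left A_bounds by simp
    next
      case False then show ?thesis using AH[of y] A_bounds(1)[of "2*L-y"] by (simp add: \<psi>_def)
    qed
    fix F :: "real \<Rightarrow> real \<Rightarrow> ennreal"
    assume Fm: "(\<lambda>w. F (fst w) (snd w)) \<in> borel_measurable (borel \<Otimes>\<^sub>M borel)" and F0: "F 0 0 = 0"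
    have [measurable]: "(\<lambda>x. F (f x) (g x)) \<in> borel_measurable borel" if "f \<in> borel_measurable borel" "g \<in> borel_measurable borel" for f g :: "real \<Rightarrow> real"
    proof -
      have "(\<lambda>x. (f x, g x)) \<in> borel \<rightarrow>\<^sub>M borel \<Otimes>\<^sub>M borel" using that by measurable
      from measurable_compose[OF this Fm] show ?thesis by simp
    qed
    \<comment> \<open>The left half of the integrand; the right half is its image under the
      reflection at \<open>L\<close>, which preserves the integral.\<close>
    let ?h = "\<lambda>x. indicator {..<L} x * F (A x) (D x)"
    have "(\<integral>\<^sup>+ y. F (\<psi> y) \<bar>d y\<bar> \<partial>lborel) = (\<integral>\<^sup>+ y. ?h y + ?h (2 * L + (-1) * y) \<partial>lborel)"
    proof (rule nn_integral_cong_AE)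
      show "AE y in lborel. F (\<psi> y) \<bar>d y\<bar> = ?h y + ?h (2 * L + (-1) * y)"
        using AE_lborel_singleton[of L]
      proof eventually_elim
        fix y assume "y \<noteq> L"
        then show "F (\<psi> y) \<bar>d y\<bar> = ?h y + ?h (2 * L + (-1) * y)"
          using left[of y] right[of y] by (cases "y < L") auto
      qed
    qed
    also have "\<dots> = (\<integral>\<^sup>+ y. ?h y \<partial>lborel) + (\<integral>\<^sup>+ y. ?h (2 * L + (-1) * y) \<partial>lborel)"
      by (rule nn_integral_add) measurable
    also have "(\<integral>\<^sup>+ y. ?h (2 * L + (-1) * y) \<partial>lborel) = (\<integral>\<^sup>+ y. ?h y \<partial>lborel)"
      using nn_integral_real_affine[of ?h "-1" "2 * L"] by simp
    also have "(\<integral>\<^sup>+ y. ?h y \<partial>lborel) = (\<integral>\<^sup>+ x. ?h (Y x) * ennreal (r x) \<partial>lborel)"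
      by (rule cov[symmetric]) measurable
    also have "\<dots> = (\<integral>\<^sup>+ x. indicator {0<..<H} x * (F x (p x) * ennreal (1 / p x)) \<partial>lborel)"
    proof (intro nn_integral_cong)
      fix x :: real
      have "Y x < L \<longleftrightarrow> x < H" using Y_less[of x H] by (simp add: L_def)
      then show "?h (Y x) * ennreal (r x) = indicator {0<..<H} x * (F x (p x) * ennreal (1 / p x))"
        using F0 \<open>0 < H\<close> by (auto simp: AY DY r_def indicator_def)
    qed
    finally show "(\<integral>\<^sup>+ y. F (\<psi> y) \<bar>d y\<bar> \<partial>lborel) = 2 * (\<integral>\<^sup>+ x. indicator {0<..<H} x * (F x (p x) * ennreal (1 / p x)) \<partial>lborel)"
      by (simp add: mult_2)
  qed measurable
qed


lemma tau_le_energy: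
  assumes "\<And>y. 0 \<le> \<psi> y" "has_bochner_integral lborel \<psi> w" "weak_deriv \<psi> d"
  shows "tau z w \<le> (\<integral>\<^sup>+ y. ennreal (1/2 * (d y)\<^sup>2) + cfun z \<bar>\<psi> y\<bar> \<partial>lborel)"
proof -
  have "tau z w \<le> energy (cfun z) \<psi>" unfolding tau_def by (rule INF_lower) (use assms in auto)
  also have "\<dots> \<le> (\<integral>\<^sup>+ y. ennreal (1/2 * (d y)\<^sup>2) + cfun z \<bar>\<psi> y\<bar> \<partial>lborel)"
    unfolding energy_def by (rule INF_lower) (use assms in auto)
  finally show ?thesis .
qed

lemma tau_0: "tau z 0 = 0"
proof -
  have "weak_deriv (\<lambda>_. 0) (\<lambda>_. 0)" by (simp add: weak_deriv_def set_integrable_def)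
  moreover have "has_bochner_integral lborel (\<lambda>_. 0 :: real) 0" by (simp add: has_bochner_integral_iff)
  ultimately show ?thesis using tau_le_energy[of "\<lambda>_. 0" 0 "\<lambda>_. 0" z] by (simp add: cfun_def)
qed

text \<open>An infinite \<open>z x\<close> would force the density to be infinite on all of
  \<open>(0, x)\<close>.\<close>

lemma optimal_density_integrable_imp_finite:
  assumes z: "nonincr_on_nonneg z" and fin: "(\<integral>\<^sup>+ x. optimal_density z s x \<partial>lborel) < \<infinity>" and "0 < x"
  shows "z x < \<infinity>"
proof (rule ccontr)
  assume "\<not> z x < \<infinity>"
  then have zx: "z x = \<infinity>" by (simp add: less_top[symmetric])
  have "\<infinity> = (\<integral>\<^sup>+ y. \<infinity> * indicator {0<..<x} y \<partial>lborel)"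
    using \<open>0 < x\<close> by (subst nn_integral_cmult_indicator) (auto simp: ennreal_top_mult)
  also have "\<dots> \<le> (\<integral>\<^sup>+ x. optimal_density z s x \<partial>lborel)"
  proof (intro nn_integral_mono)
    fix y
    have "z x \<le> z y" if "0 < y" "y < x" using z that unfolding nonincr_on_nonneg_def by auto
    then show "\<infinity> * indicator {0<..<x} y \<le> optimal_density z s y"
      using zx by (cases "0 < y \<and> y < x") (auto simp: indicator_def optimal_density_def top_unique)
  qed
  finally show False using fin by (simp add: top_unique)
qed

text \<open>The profile has slope \<open>p\<close>, the root of the squared optimal slope plus
  \<open>\<eta>\<^sup>2\<close>, and is cut at the height \<open>H\<close> where its mass is
  \<open>w\<close>. Since \<open>p\<close> exceeds \<open>q\<close> by at most \<eta>, the excess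
  over the claimed bound is at most \<open>2 * \<eta> * H\<close>.\<close>

lemma tau_upper_bound:
  assumes z: "nonincr_on_nonneg z" and "0 \<le> s" "0 \<le> w"
  shows "tau z w \<le> (\<integral>\<^sup>+ x. optimal_density z s x \<partial>lborel) + ennreal (s * w)" (is "_ \<le> ?G + _")
proof (cases "w = 0 \<or> ?G = \<infinity>")
  case True
  then show ?thesis using tau_0 by auto
next
  case False
  with \<open>0 \<le> w\<close> have "0 < w" and fin: "?G < \<infinity>" by (auto simp: less_top[symmetric])
  note zfin = optimal_density_integrable_imp_finite[OF z fin]
  note [measurable] = borel_measurable_nonincr[OF z]
  define u where "u x = enn2real (z (max 0 x))" for x
  have [measurable]: "u \<in> borel_measurable borel" unfolding u_def by measurable
  have zu: "z x = ennreal (u x)" if "0 < x" for x using zfin[OF that] that by (simp add: u_def max_def)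
  have u0: "0 \<le> u x" for x by (simp add: u_def)
  have u_anti: "u y \<le> u x" if "0 < x" "x \<le> y" for x y
    using z that zfin[of x] unfolding nonincr_on_nonneg_def u_def by (intro enn2real_mono) (auto simp: max_def)
  \<comment> \<open>bounds, uniformly in the regularisation \<open>\<eta>\<close>, the height at which mass \<open>w\<close> is reached\<close>
  define Hmax where "Hmax = 1 + w * sqrt (2 * u 1 + 1) / 2"
  have Hmax: "1 \<le> Hmax" using \<open>0 < w\<close> u0[of 1] by (simp add: Hmax_def)
  define q where "q x = sqrt (2 * x * max 0 (u x - s))" for x
  have q0: "0 \<le> q x" if "0 < x" for x using that by (simp add: q_def)
  have [measurable]: "q \<in> borel_measurable borel" unfolding q_def by measurable
  have od: "optimal_density z s x = ennreal (2 * q x)" if "0 < x" for x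
    using that zu[OF that] u0[of x] by (simp add: optimal_density_def q_def)
  have bound: "tau z w \<le> ?G + ennreal (s * w) + ennreal (2 * \<eta> * Hmax)" if \<eta>: "0 < \<eta>" "\<eta> \<le> 1" for \<eta>
  proof -
    define p where "p x = sqrt ((q x)\<^sup>2 + \<eta>\<^sup>2)" for x
    have [measurable]: "p \<in> borel_measurable borel" unfolding p_def by measurable
    have p_ge: "\<eta> \<le> p x" for x using \<eta> by (simp add: p_def real_le_rsqrt)
    then have p_pos: "0 < p x" for x using \<eta> by (meson less_le_trans)
    have p_le: "p x \<le> q x + \<eta>" if "0 < x" for x
      unfolding p_def using q0[OF that] \<eta> by (intro sqrt_sum_squares_le_sum) auto
    have p2: "(p x)\<^sup>2 = 2 * x * max 0 (u x - s) + \<eta>\<^sup>2" if "0 < x" for x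
      using that by (simp add: p_def q_def)
    \<comment> \<open>The mass density over heights: each flank contributes height \<open>x\<close>
      times the length \<open>1 / p x\<close> spent per unit of height.\<close>
    define f where "f x = 2 * x / p x" for x
    have [measurable]: "f \<in> borel_measurable borel" unfolding f_def by measurable
    have f0: "0 \<le> f x" if "0 \<le> x" for x using that p_pos[of x] by (simp add: f_def)
    have f_le: "f x \<le> 2 * x / \<eta>" if "0 \<le> x" for x using that p_ge[of x] \<eta> unfolding f_def by (intro divide_left_mono) (auto intro: mult_pos_pos p_pos)
    have fset: "set_integrable lborel {0..b} f" for b
      unfolding set_integrable_def
    proof (rule Bochner_Integration.integrable_bound)
      show "integrable lborel (\<lambda>x. indicator {0..b} x * (2 * b / \<eta>))"
        by (simp add: integrable_indicator_iff emeasure_lborel_Icc_eq)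
      show "AE x in lborel. norm (indicator {0..b} x *\<^sub>R f x) \<le> norm (indicator {0..b} x * (2 * b / \<eta>))"
      proof (rule AE_I2)
        fix x
        have "\<bar>f x\<bar> \<le> \<bar>2 * b / \<eta>\<bar>" if "0 \<le> x" "x \<le> b"
          using f0[OF that(1)] f_le[OF that(1)] that \<eta> order_trans[of "f x" "2 * x / \<eta>" "2 * b / \<eta>"]
          by (auto simp: divide_right_mono)
        then show "norm (indicator {0..b} x *\<^sub>R f x) \<le> norm (indicator {0..b} x * (2 * b / \<eta>))"
          by (auto simp: indicator_def)
      qed
    qed measurable
    have fint: "f integrable_on {0..b}" for b using set_borel_integral_eq_integral(1)[OF fset] .
    \<comment> \<open>From height 1 on, \<open>u x \<le> u 1\<close> and
      \<open>\<eta> \<le> 1\<close> give \<open>p x \<le> x * sqrt (2 * u 1 + 1)\<close>, so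
      \<open>f\<close> is at least \<open>2 / sqrt (2 * u 1 + 1)\<close>. \<open>Hmax\<close> is
      chosen so that this constant integrates to exactly \<open>w\<close> over
      \<open>[1, Hmax]\<close>.\<close>
    have "w \<le> integral {0..Hmax} f"
    proof -
      let ?\<kappa> = "1 / sqrt (2 * u 1 + 1)"
      have "w = integral {1..Hmax} (\<lambda>_. 2 * ?\<kappa>)" using Hmax u0[of 1] by (simp add: Hmax_def)
      also have "\<dots> \<le> integral {1..Hmax} f"
      proof (rule integral_le)
        show "f integrable_on {1..Hmax}" by (rule integrable_on_subinterval[OF fint[of Hmax]]) auto
        fix x assume "x \<in> {1..Hmax}"
        then have x: "1 \<le> x" by simp
        have "(p x)\<^sup>2 \<le> 2 * x * u 1 + 1"
        proof -
          have "max 0 (u x - s) \<le> u 1" using u_anti[of 1 x] x \<open>0 \<le> s\<close> u0[of 1] by simp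
          then have "2 * x * max 0 (u x - s) \<le> 2 * x * u 1" using x by (intro mult_left_mono) auto
          moreover have "\<eta>\<^sup>2 \<le> 1" using \<eta> by (simp add: power_le_one)
          ultimately show ?thesis using p2[of x] x by linarith
        qed
        also have "\<dots> \<le> x\<^sup>2 * (2 * u 1 + 1)"
        proof -
          have "x \<le> x\<^sup>2" "1 \<le> x\<^sup>2" using x by (auto simp: self_le_power)
          then have "x * (2 * u 1) \<le> x\<^sup>2 * (2 * u 1)" using u0[of 1] by (intro mult_right_mono) auto
          then show ?thesis using \<open>1 \<le> x\<^sup>2\<close> by (simp add: algebra_simps)
        qed
        finally have "p x \<le> sqrt (x\<^sup>2 * (2 * u 1 + 1))" by (rule real_le_rsqrt)
        also have "\<dots> = x * sqrt (2 * u 1 + 1)" using x by (simp add: real_sqrt_mult)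
        finally show "2 * ?\<kappa> \<le> f x"
          using p_pos[of x] u0[of 1] x by (simp add: f_def field_simps)
      qed auto
      also have "\<dots> \<le> integral {0..Hmax} f"
        using Hmax fint f0 by (intro integral_subset_le integrable_on_subinterval[OF fint[of Hmax]]) auto
      finally show ?thesis .
    qed
    then have "\<exists>H\<ge>0. H \<le> Hmax \<and> integral {0..H} f = w"
      using Hmax \<open>0 < w\<close> by (intro IVT' indefinite_integral_continuous_1 fint) auto
    then obtain H where H: "0 \<le> H" "H \<le> Hmax" "integral {0..H} f = w" by blast
    with \<open>0 < w\<close> have "0 < H" by (cases "H = 0") auto
    have nnf: "(\<integral>\<^sup>+ x. indicator {0<..<H} x * ennreal (f x) \<partial>lborel) = ennreal w"
    proof -
      have "(\<integral>\<^sup>+ x. indicator {0<..<H} x * ennreal (f x) \<partial>lborel) = (\<integral>\<^sup>+ x. ennreal (indicator {0..H} x * f x) \<partial>lborel)"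
      proof (rule nn_integral_cong_AE)
        show "AE x in lborel. indicator {0<..<H} x * ennreal (f x) = ennreal (indicator {0..H} x * f x)"
          using AE_lborel_singleton[of 0] AE_lborel_singleton[of H] by eventually_elim (auto simp: indicator_def)
      qed
      also have "\<dots> = ennreal (\<integral>x. indicator {0..H} x * f x \<partial>lborel)"
        using fset[of H] f0 by (intro nn_integral_eq_integral) (auto simp: set_integrable_def indicator_def)
      also have "(\<integral>x. indicator {0..H} x * f x \<partial>lborel) = w"
        using set_borel_integral_eq_integral(2)[OF fset[of H]] H(3) by (simp add: set_lebesgue_integral_def)
      finally show ?thesis .
    qed
    obtain \<psi> d where wd: "weak_deriv \<psi> d" and \<psi>0: "\<And>y. 0 \<le> \<psi> y" and [measurable]: "\<psi> \<in> borel_measurable borel"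
      and F: "\<And>F :: real \<Rightarrow> real \<Rightarrow> ennreal. (\<lambda>w. F (fst w) (snd w)) \<in> borel_measurable (borel \<Otimes>\<^sub>M borel) \<Longrightarrow> F 0 0 = 0 \<Longrightarrow>
      (\<integral>\<^sup>+ y. F (\<psi> y) \<bar>d y\<bar> \<partial>lborel) = 2 * (\<integral>\<^sup>+ x. indicator {0<..<H} x * (F x (p x) * ennreal (1 / p x)) \<partial>lborel)"
      using symmetric_profile[OF \<open>p \<in> borel_measurable borel\<close> \<open>0 < H\<close> \<eta>(1) p_ge] by blast
    have "(\<integral>\<^sup>+ y. ennreal (\<psi> y) \<partial>lborel) = 2 * (\<integral>\<^sup>+ x. indicator {0<..<H} x * (ennreal x * ennreal (1 / p x)) \<partial>lborel)"
      by (rule F[of "\<lambda>x _. ennreal x"]) auto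
    also have "\<dots> = (\<integral>\<^sup>+ x. 2 * (indicator {0<..<H} x * (ennreal x * ennreal (1 / p x))) \<partial>lborel)"
      by (rule nn_integral_cmult[symmetric]) measurable
    also have "\<dots> = (\<integral>\<^sup>+ x. indicator {0<..<H} x * ennreal (f x) \<partial>lborel)"
    proof (rule nn_integral_cong)
      fix x
      show "2 * (indicator {0<..<H} x * (ennreal x * ennreal (1 / p x))) = indicator {0<..<H} x * ennreal (f x)"
      proof (cases "x \<in> {0<..<H}")
        case True
        then have "ennreal 2 * (ennreal x * ennreal (1 / p x)) = ennreal (f x)"
          using p_pos[of x] by (simp add: f_def ennreal_mult[symmetric] del: ennreal_numeral)
        then show ?thesis using True by simp
      qed simp
    qed
    finally have mass: "(\<integral>\<^sup>+ y. ennreal (\<psi> y) \<partial>lborel) = ennreal w" using nnf by simp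
    have hb: "has_bochner_integral lborel \<psi> w"
      by (rule has_bochner_integral_nn_integral) (use mass \<psi>0 \<open>0 < w\<close> in auto)
    have "tau z w \<le> (\<integral>\<^sup>+ y. ennreal (1/2 * (d y)\<^sup>2) + cfun z \<bar>\<psi> y\<bar> \<partial>lborel)"
      by (rule tau_le_energy[OF \<psi>0 hb wd])
    also have "\<dots> = (\<integral>\<^sup>+ y. ennreal (1/2 * \<bar>d y\<bar>\<^sup>2) + cfun z (max 0 (\<psi> y)) \<partial>lborel)"
      using \<psi>0 by (simp add: max_absorb2)
    also have "\<dots> = 2 * (\<integral>\<^sup>+ x. indicator {0<..<H} x * ((ennreal (1/2 * (p x)\<^sup>2) + cfun z (max 0 x)) * ennreal (1 / p x)) \<partial>lborel)"
    proof (rule F[of "\<lambda>x y. ennreal (1/2 * y\<^sup>2) + cfun z (max 0 x)"])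
      have "(\<lambda>x. cfun z (max 0 x)) = (\<lambda>x. if x \<le> 0 then 0 else z (max 0 x) * ennreal x)" by (auto simp: cfun_def fun_eq_iff max_def)
      moreover have "\<dots> \<in> borel_measurable borel" by measurable
      ultimately have [measurable]: "(\<lambda>x. cfun z (max 0 x)) \<in> borel_measurable borel" by simp
      show "(\<lambda>w. ennreal (1/2 * (snd w)\<^sup>2) + cfun z (max 0 (fst w))) \<in> borel_measurable (borel \<Otimes>\<^sub>M borel)"
        by measurable
    qed (simp add: cfun_def)
    also have "\<dots> = (\<integral>\<^sup>+ x. 2 * (indicator {0<..<H} x * ((ennreal (1/2 * (p x)\<^sup>2) + cfun z (max 0 x)) * ennreal (1 / p x))) \<partial>lborel)"
    proof (rule nn_integral_cmult[symmetric])
      have "(\<lambda>x. indicator {0<..<H} x * ((ennreal (1/2 * (p x)\<^sup>2) + cfun z (max 0 x)) * ennreal (1 / p x))) =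
         (\<lambda>x. indicator {0<..<H} x * ((ennreal (1/2 * (p x)\<^sup>2) + z (max 0 x) * ennreal x) * ennreal (1 / p x)))"
        by (auto simp: fun_eq_iff indicator_def cfun_def max_def)
      also have "\<dots> \<in> borel_measurable lborel" by measurable
      finally show "(\<lambda>x. indicator {0<..<H} x * ((ennreal (1/2 * (p x)\<^sup>2) + cfun z (max 0 x)) * ennreal (1 / p x))) \<in> borel_measurable lborel" .
    qed
    also have "\<dots> \<le> (\<integral>\<^sup>+ x. (optimal_density z s x + ennreal s * (indicator {0<..<H} x * ennreal (f x))) + ennreal (2 * \<eta>) * indicator {0<..<H} x \<partial>lborel)"
    proof (rule nn_integral_mono)
      fix x
      show "2 * (indicator {0<..<H} x * ((ennreal (1/2 * (p x)\<^sup>2) + cfun z (max 0 x)) * ennreal (1 / p x))) \<le>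
         (optimal_density z s x + ennreal s * (indicator {0<..<H} x * ennreal (f x))) + ennreal (2 * \<eta>) * indicator {0<..<H} x"
      proof (cases "x \<in> {0<..<H}")
        case True
        then have x: "0 < x" by simp
        have c: "cfun z (max 0 x) = ennreal (u x * x)" using x zu[OF x] u0[of x] by (simp add: cfun_def max_def ennreal_mult)
        \<comment> \<open>The potential term is at most \<open>(p x)\<^sup>2 / 2 + s * x\<close>,
          with the truncation at 0 absorbing the heights where \<open>u x < s\<close>. Kinetic and
          potential parts together are then at most \<open>(p x)\<^sup>2 + s * x\<close>; division
          by \<open>p x\<close> and doubling leave \<open>2 * p x + s * f x\<close>.\<close>
        have "x * (u x - s) \<le> x * max 0 (u x - s)" using x by (intro mult_left_mono) auto
        then have "u x * x \<le> (p x)\<^sup>2 / 2 + s * x"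
        proof -
          have "(p x)\<^sup>2 / 2 = x * max 0 (u x - s) + \<eta>\<^sup>2 / 2" using p2[OF x] by simp
          moreover have "x * (u x - s) = u x * x - s * x" by (simp add: algebra_simps)
          ultimately show ?thesis using \<open>x * (u x - s) \<le> _\<close> zero_le_power2[of \<eta>] by linarith
        qed
        then have "1/2 * (p x)\<^sup>2 + u x * x \<le> p x * p x + s * x" by (simp add: power2_eq_square)
        then have "2 * ((1/2 * (p x)\<^sup>2 + u x * x) * (1 / p x)) \<le> 2 * ((p x * p x + s * x) * (1 / p x))"
          using p_pos[of x] by (intro mult_left_mono mult_right_mono) auto
        also have "\<dots> = 2 * p x + s * f x" using p_pos[of x] by (simp add: f_def field_simps)
        also have "\<dots> \<le> 2 * q x + s * f x + 2 * \<eta>" using p_le[OF x] by simp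
        finally have "ennreal (2 * ((1/2 * (p x)\<^sup>2 + u x * x) * (1 / p x))) \<le> ennreal (2 * q x + s * f x + 2 * \<eta>)" by (rule ennreal_leI)
        moreover have "ennreal (2 * ((1/2 * (p x)\<^sup>2 + u x * x) * (1 / p x))) = ennreal 2 * ((ennreal (1/2 * (p x)\<^sup>2) + ennreal (u x * x)) * ennreal (1 / p x))"
          using p_pos[of x] u0[of x] x by (simp add: ennreal_mult[symmetric] ennreal_plus[symmetric] del: ennreal_plus ennreal_numeral)
        moreover have "ennreal (2 * q x + s * f x + 2 * \<eta>) = ennreal (2 * q x) + ennreal s * ennreal (f x) + ennreal (2 * \<eta>)"
          using q0[OF x] f0[of x] x \<eta> \<open>0 \<le> s\<close> by (simp add: ennreal_plus ennreal_mult)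
        ultimately show ?thesis unfolding c od[OF x] using True by simp
      qed simp
    qed
    also have "\<dots> = ?G + ennreal s * (\<integral>\<^sup>+ x. indicator {0<..<H} x * ennreal (f x) \<partial>lborel) + ennreal (2 * \<eta>) * ennreal H"
    proof -
      note [measurable] = measurable_optimal_density[OF z]
      have "(\<integral>\<^sup>+ x. ennreal s * (indicator {0<..<H} x * ennreal (f x)) \<partial>lborel) = ennreal s * (\<integral>\<^sup>+ x. indicator {0<..<H} x * ennreal (f x) \<partial>lborel)"
        by (rule nn_integral_cmult) measurable
      moreover have "(\<integral>\<^sup>+ x. ennreal (2 * \<eta>) * indicator {0<..<H} x \<partial>lborel) = ennreal (2 * \<eta>) * ennreal H"
        using \<open>0 < H\<close> by (subst nn_integral_cmult_indicator) auto
      ultimately show ?thesis by (subst nn_integral_add; (subst nn_integral_add)?) auto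
    qed
    also have "\<dots> \<le> ?G + ennreal (s * w) + ennreal (2 * \<eta> * Hmax)"
    proof -
      have "ennreal (2 * \<eta>) * ennreal H \<le> ennreal (2 * \<eta> * Hmax)"
        using \<eta> H by (subst ennreal_mult[symmetric]) (auto intro!: ennreal_leI)
      moreover have "ennreal s * ennreal w = ennreal (s * w)" using \<open>0 \<le> s\<close> \<open>0 < w\<close> by (simp add: ennreal_mult)
      ultimately show ?thesis unfolding nnf by (simp add: add_left_mono)
    qed
    finally show ?thesis .
  qed
  show ?thesis
  proof (rule ennreal_le_epsilon)
    fix e :: real assume "0 < e"
    define \<eta> where "\<eta> = min 1 (e / (2 * Hmax))"
    have "0 < \<eta>" "\<eta> \<le> 1" using \<open>0 < e\<close> Hmax by (auto simp: \<eta>_def)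
    moreover have "2 * \<eta> * Hmax \<le> e"
    proof -
      have "\<eta> \<le> e / (2 * Hmax)" by (simp add: \<eta>_def)
      then show ?thesis using Hmax by (simp add: field_simps)
    qed
    ultimately show "tau z w \<le> ?G + ennreal (s * w) + ennreal e"
      by (meson bound add_left_mono ennreal_leI order_trans)
  qed
qed

section \<open>The conjugate at derivative values\<close>

text \<open>The \<open>s\<close> of \<open>energy_lower_bound\<close> depends on the profile, and no
  minimiser is available, so a profile within \<open>e\<close> of the infimum is used.\<close>

lemma tau_near_lower_bound:
  assumes z: "nonincr_on_nonneg z" "lsc_on_nonneg z" and "0 < w" "0 < e"
  shows "\<exists>s\<ge>0. (\<integral>\<^sup>+ x. optimal_density z s x \<partial>lborel) + ennreal (s * w) \<le> tau z w + ennreal e"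
proof (cases "tau z w = \<infinity>")
  case True
  then show ?thesis by (intro exI[of _ 0]) simp
next
  case False
  then have "tau z w < tau z w + ennreal e" using \<open>0 < e\<close> 
    by (cases "tau z w") (auto simp: ennreal_plus[symmetric] ennreal_less_iff simp del: ennreal_plus)
  then obtain \<psi> where \<psi>: "\<And>y. 0 \<le> \<psi> y" "has_bochner_integral lborel \<psi> w" "energy (cfun z) \<psi> < tau z w + ennreal e"
    unfolding tau_def[of z w] by (auto simp: INF_less_iff)
  then obtain d where d: "weak_deriv \<psi> d" "(\<integral>\<^sup>+ y. ennreal (1/2 * (d y)\<^sup>2) + cfun z \<bar>\<psi> y\<bar> \<partial>lborel) < tau z w + ennreal e"
    unfolding energy_def by (auto simp: INF_less_iff)
  show ?thesis using energy_lower_bound[OF z \<open>0 < w\<close> \<psi>(1,2) d(1)] d(2) by (meson less_imp_le order_trans)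
qed

lemma nn_integral_optimal_density_lsc:
  assumes z: "nonincr_on_nonneg z" and s: "s \<longlonglongrightarrow> t"
  shows "(\<integral>\<^sup>+ x. optimal_density z t x \<partial>lborel) \<le> liminf (\<lambda>n. \<integral>\<^sup>+ x. optimal_density z (s n) x \<partial>lborel)"
proof -
  have "(\<integral>\<^sup>+ x. optimal_density z t x \<partial>lborel) = (\<integral>\<^sup>+ x. liminf (\<lambda>n. optimal_density z (s n) x) \<partial>lborel)"
  proof (rule nn_integral_cong)
    fix x
    have "(\<lambda>n. optimal_density z (s n) x) \<longlonglongrightarrow> optimal_density z t x"
      unfolding optimal_density_def by (cases "x \<le> 0"; cases "z x = \<infinity>") (auto intro!: tendsto_intros s)
    then show "optimal_density z t x = liminf (\<lambda>n. optimal_density z (s n) x)"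
      by (intro lim_imp_Liminf[symmetric]) auto
  qed
  also have "\<dots> \<le> liminf (\<lambda>n. \<integral>\<^sup>+ x. optimal_density z (s n) x \<partial>lborel)"
    by (rule nn_integral_liminf) (simp add: measurable_optimal_density[OF z])
  finally show ?thesis .
qed

text \<open>Each \<open>s n\<close> gives a line lying above \<tau> and within
  \<open>h n * h n\<close> of it at \<open>w + h n\<close>. Comparing at \<open>w\<close> and at
  \<open>w + 2 * h n\<close> squeezes \<open>s n\<close> between two expressions that tend to
  \<open>t\<close>. Only masses to the right of \<open>w\<close> occur, so \<open>w = 0\<close> with
  its right derivative is included.\<close>

lemma optimal_density_integral_at_derivative:
  assumes z: "nonincr_on_nonneg z" "lsc_on_nonneg z" and "0 \<le> w"
    and fin: "tau z w \<noteq> \<infinity>" "\<forall>\<^sub>F v in at w within {0..}. tau z v \<noteq> \<infinity>"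
    and deriv: "((\<lambda>v. enn2real (tau z v)) has_real_derivative t) (at w within {0..})"
  shows "(\<integral>\<^sup>+ x. optimal_density z t x \<partial>lborel) \<le> ennreal (enn2real (tau z w) - t * w)"
    and "0 \<le> enn2real (tau z w) - t * w"
proof -
  define T where "T v = enn2real (tau z v)" for v
  define h where "h n = 1 / real (Suc n)" for n
  have h: "0 < h n" for n by (simp add: h_def)
  have h0: "h \<longlonglongrightarrow> 0" unfolding h_def using lim_1_over_n[THEN LIMSEQ_Suc] by simp
  have X: "filterlim (\<lambda>n. w + c * h n) (at w within {0..}) sequentially" if "0 < c" for c
    unfolding filterlim_at
  proof
    show "\<forall>\<^sub>F n in sequentially. w + c * h n \<in> {0..} \<and> w + c * h n \<noteq> w"
      using \<open>0 \<le> w\<close> that h by (auto intro!: always_eventually add_nonneg_nonneg simp: less_imp_le order_less_imp_not_eq2)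
    show "(\<lambda>n. w + c * h n) \<longlonglongrightarrow> w" using tendsto_add[OF tendsto_const tendsto_mult[OF tendsto_const h0], of w c] by simp
  qed
  have finX: "\<forall>\<^sub>F n in sequentially. tau z (w + c * h n) \<noteq> \<infinity>" if "0 < c" for c
    using filterlim_iff[THEN iffD1, OF X[OF that]] fin(2) by blast
  have quot: "(\<lambda>n. (T (w + c * h n) - T w) / (c * h n)) \<longlonglongrightarrow> t" if "0 < c" for c
    using filterlim_compose[OF deriv[unfolded has_field_derivative_iff] X[OF that]] by (simp add: T_def)
  \<comment> \<open>The tolerance \<open>h n * h n\<close> still tends to 0 after division by the
    step \<open>h n\<close>. The mass \<open>w + h n\<close> is positive even if
    \<open>w = 0\<close>, as \<open>tau_near_lower_bound\<close> requires.\<close>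
  have "\<forall>n. \<exists>s\<ge>0. (\<integral>\<^sup>+ x. optimal_density z s x \<partial>lborel) + ennreal (s * (w + 1 * h n)) \<le> tau z (w + 1 * h n) + ennreal (h n * h n)"
    using tau_near_lower_bound[OF z] h \<open>0 \<le> w\<close> by (simp add: add_nonneg_pos)
  then obtain s where s0: "\<And>n. 0 \<le> s n"
    and s: "\<And>n. (\<integral>\<^sup>+ x. optimal_density z (s n) x \<partial>lborel) + ennreal (s n * (w + 1 * h n)) \<le> tau z (w + 1 * h n) + ennreal (h n * h n)"
    by metis
  \<comment> \<open>The bound on the integral at \<open>s n\<close> left by near-optimality; it
    converges to the intercept \<open>T w - t * w\<close>.\<close>
  define e where "e n = T (w + 1 * h n) + h n * h n - s n * (w + 1 * h n)" for n
  have key: "\<forall>\<^sub>F n in sequentially. 0 \<le> e n \<and> (\<integral>\<^sup>+ x. optimal_density z (s n) x \<partial>lborel) \<le> ennreal (e n) \<and>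
      s n \<le> (T (w + 1 * h n) - T w) / (1 * h n) + h n \<and>
      2 * ((T (w + 2 * h n) - T w) / (2 * h n)) - (T (w + 1 * h n) - T w) / (1 * h n) - h n \<le> s n"
    using finX[of 1, simplified] finX[of 2, simplified]
  proof eventually_elim
    fix n assume f: "tau z (w + h n) \<noteq> top" "tau z (w + 2 * h n) \<noteq> top"
    have T1: "tau z (w + h n) = ennreal (T (w + h n))" and T2: "tau z (w + 2 * h n) = ennreal (T (w + 2 * h n))" and T0: "tau z w = ennreal (T w)"
      using f fin(1) by (simp_all add: T_def less_top)
    have Tn: "0 \<le> T v" for v by (simp add: T_def)
    let ?G = "\<integral>\<^sup>+ x. optimal_density z (s n) x \<partial>lborel"
    have wh: "0 \<le> w + h n" using \<open>0 \<le> w\<close> h[of n] by simp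
    have le: "?G + ennreal (s n * (w + h n)) \<le> ennreal (T (w + h n) + h n * h n)"
      using s[of n] T1 h[of n] Tn[of "w + h n"] by (simp add: ennreal_plus)
    then have "?G < top" by (metis add_lessD1 ennreal_less_top le_less_trans ennreal_add_eq_top top.not_eq_extremum)
    then obtain g where g: "0 \<le> g" "?G = ennreal g" by (cases ?G) auto
    have 1: "g + s n * (w + h n) \<le> T (w + h n) + h n * h n"
    proof -
      have "ennreal (g + s n * (w + h n)) \<le> ennreal (T (w + h n) + h n * h n)"
        using le g s0[of n] wh by (simp add: ennreal_plus)
      then show ?thesis using h[of n] Tn[of "w + h n"] by (subst (asm) ennreal_le_iff) auto
    qed
    have up: "T v \<le> g + s n * v" if "0 \<le> v" "tau z v = ennreal (T v)" for v
    proof -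
      have "ennreal (T v) \<le> ennreal (g + s n * v)"
        using tau_upper_bound[OF z(1) s0[of n] that(1)] that g s0[of n] by (simp add: ennreal_plus)
      then show ?thesis using g(1) s0[of n] that(1) by (subst (asm) ennreal_le_iff) auto
    qed
    have 2: "T w \<le> g + s n * w" using up[OF \<open>0 \<le> w\<close> T0] .
    have 3: "T (w + 2 * h n) \<le> g + s n * (w + 2 * h n)" using up[OF _ T2] \<open>0 \<le> w\<close> h[of n] by simp
    have 4: "s n * h n \<le> T (w + h n) - T w + h n * h n" using 1 2 by (simp add: algebra_simps)
    have 5: "T (w + 2 * h n) - T (w + h n) - h n * h n \<le> s n * h n" using 1 3 by (simp add: algebra_simps)
    have "s n \<le> (T (w + h n) - T w) / h n + h n" using 4 h[of n] by (simp add: field_simps)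
    \<comment> \<open>The first two terms combine to the difference quotient of \<open>T\<close>
      between \<open>w + h n\<close> and \<open>w + 2 * h n\<close>; written from the base point
      \<open>w\<close>, they tend to \<open>2 * t - t\<close>.\<close>
    moreover have "2 * ((T (w + 2 * h n) - T w) / (2 * h n)) - (T (w + h n) - T w) / h n - h n \<le> s n"
      using 5 h[of n] by (simp add: field_simps)
    moreover have "g \<le> e n" using 1 by (simp add: e_def)
    ultimately show "0 \<le> e n \<and> ?G \<le> ennreal (e n) \<and> s n \<le> (T (w + 1 * h n) - T w) / (1 * h n) + h n \<and>
      2 * ((T (w + 2 * h n) - T w) / (2 * h n)) - (T (w + 1 * h n) - T w) / (1 * h n) - h n \<le> s n"
      using g by (auto intro: ennreal_leI)
  qed
  have slim: "s \<longlonglongrightarrow> t"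
  proof (rule tendsto_sandwich)
    show "\<forall>\<^sub>F n in sequentially. s n \<le> (T (w + 1 * h n) - T w) / (1 * h n) + h n"
      using key by eventually_elim blast
    show "\<forall>\<^sub>F n in sequentially. 2 * ((T (w + 2 * h n) - T w) / (2 * h n)) - (T (w + 1 * h n) - T w) / (1 * h n) - h n \<le> s n"
      using key by eventually_elim blast
    show "(\<lambda>n. (T (w + 1 * h n) - T w) / (1 * h n) + h n) \<longlonglongrightarrow> t"
      using tendsto_add[OF quot[OF zero_less_one] h0] by simp
    show "(\<lambda>n. 2 * ((T (w + 2 * h n) - T w) / (2 * h n)) - (T (w + 1 * h n) - T w) / (1 * h n) - h n) \<longlonglongrightarrow> t"
      using tendsto_diff[OF tendsto_diff[OF tendsto_mult[OF tendsto_const[of 2] quot[of 2]] quot[OF zero_less_one]] h0] by simp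
  qed
  have "(\<lambda>n. T (w + 1 * h n)) \<longlonglongrightarrow> T w"
  proof -
    have "(T \<longlongrightarrow> T w) (at w within {0..})"
      using DERIV_continuous[OF deriv] by (simp add: T_def[abs_def] continuous_within)
    from filterlim_compose[OF this X[OF zero_less_one]] show ?thesis .
  qed
  then have "e \<longlonglongrightarrow> T w + 0 * 0 - t * (w + 1 * 0)"
    unfolding e_def by (intro tendsto_intros h0 slim)
  then have elim: "e \<longlonglongrightarrow> T w - t * w" by simp
  show "0 \<le> enn2real (tau z w) - t * w"
    using key by (intro tendsto_lowerbound[OF elim[unfolded T_def]]) (auto elim: eventually_mono)
  have "(\<integral>\<^sup>+ x. optimal_density z t x \<partial>lborel) \<le> liminf (\<lambda>n. \<integral>\<^sup>+ x. optimal_density z (s n) x \<partial>lborel)"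
    by (rule nn_integral_optimal_density_lsc[OF z(1) slim])
  also have "\<dots> \<le> liminf (\<lambda>n. ennreal (e n))"
    by (rule Liminf_mono) (use key in \<open>auto elim: eventually_mono\<close>)
  also have "\<dots> = ennreal (T w - t * w)"
    by (rule lim_imp_Liminf) (auto intro: elim tendsto_ennrealI)
  finally show "(\<integral>\<^sup>+ x. optimal_density z t x \<partial>lborel) \<le> ennreal (enn2real (tau z w) - t * w)"
    by (simp add: T_def)
qed

text \<open>For negative \<open>t\<close> the density stays above a positive constant on all heights
  beyond 1, even where \<open>z\<close> vanishes. Together with \<open>conj_tau_neg\<close> this
  makes both sides of the theorem infinite.\<close>

lemma nn_integral_optimal_density_neg:
  assumes "t < 0"
  shows "(\<integral>\<^sup>+ x. optimal_density z t x \<partial>lborel) = \<infinity>"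
proof -
  define c where "c = 2 * sqrt (2 * (- t))"
  have "c > 0" using assms by (simp add: c_def)
  have "\<infinity> = (\<integral>\<^sup>+ x. ennreal c * indicator {1<..} (x::real) \<partial>lborel)"
    by (rule nn_integral_half_line_const[OF \<open>c > 0\<close>, where y = 1, symmetric]) simp
  also have "\<dots> \<le> (\<integral>\<^sup>+ x. optimal_density z t x \<partial>lborel)"
  proof (rule nn_integral_mono)
    fix x :: real
    show "ennreal c * indicator {1<..} x \<le> optimal_density z t x"
    proof (cases "1 < x \<and> z x \<noteq> \<infinity>")
      case True
      have "- t \<le> max 0 (enn2real (z x) - t)" using enn2real_nonneg[of "z x"] by linarith
      then have "1 * (- t) \<le> x * max 0 (enn2real (z x) - t)"
        using True assms by (intro mult_mono) auto
      then have "c \<le> 2 * sqrt (2 * x * max 0 (enn2real (z x) - t))" by (simp add: c_def)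
      then show ?thesis using True by (simp add: optimal_density_def ennreal_leI)
    next
      case False
      then show ?thesis by (cases "1 < x") (auto simp: optimal_density_def)
    qed
  qed
  finally show ?thesis by (simp add: top_unique)
qed

text \<open>As \<tau> is nonnegative, the term \<open>- (t * w)\<close> alone is unbounded in
  \<open>w\<close>.\<close>

lemma conj_tau_neg:
  assumes "t < 0"
  shows "conj_tau z t = \<infinity>"
proof (rule ereal_top)
  fix B :: real
  define w where "w = max 0 B / (- t)"
  have "0 \<le> w" using assms unfolding w_def by (intro divide_nonneg_pos) auto
  have "B \<le> - (t * w)" using assms by (simp add: w_def)
  then have "ereal B \<le> 0 - ereal (t * w)" by simp
  also have "\<dots> \<le> enn2ereal (tau z w) - ereal (t * w)" by (intro ereal_minus_mono) auto
  also have "\<dots> \<le> conj_tau z t" unfolding conj_tau_def by (rule SUP_upper) (use \<open>0 \<le> w\<close> in simp)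
  finally show "ereal B \<le> conj_tau z t" .
qed

text \<open>The weak-duality half: \<open>tau_upper_bound\<close> at \<open>s = t\<close>,
  rearranged for each mass. Subtraction in \<open>ereal\<close> is safe because \<open>t * w\<close>
  is finite.\<close>

lemma conj_tau_le:
  assumes z: "nonincr_on_nonneg z" and "0 \<le> t"
  shows "conj_tau z t \<le> enn2ereal (\<integral>\<^sup>+ x. optimal_density z t x \<partial>lborel)"
  unfolding conj_tau_def
proof (rule SUP_least)
  fix w :: real assume "w \<in> {0..}"
  then have w: "0 \<le> w" by simp
  have "enn2ereal (tau z w) \<le> enn2ereal ((\<integral>\<^sup>+ x. optimal_density z t x \<partial>lborel) + ennreal (t * w))"
    using tau_upper_bound[OF z \<open>0 \<le> t\<close> w] by (simp add: less_eq_ennreal.rep_eq)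
  also have "\<dots> = enn2ereal (\<integral>\<^sup>+ x. optimal_density z t x \<partial>lborel) + ereal (t * w)"
    using w \<open>0 \<le> t\<close> by (simp add: plus_ennreal.rep_eq)
  finally show "enn2ereal (tau z w) - ereal (t * w) \<le> enn2ereal (\<integral>\<^sup>+ x. optimal_density z t x \<partial>lborel)"
    by (simp add: ereal_minus_le)
qed

theorem mainTheorem13:
  fixes z :: "real \<Rightarrow> ennreal" and t :: real
  assumes "nonincr_on_nonneg z" and "lsc_on_nonneg z"
    and "t \<in> tau_deriv_values z"
  shows "conj_tau z t = enn2ereal (conv_gr z t)"
proof (cases "t < 0")
  case True
  then show ?thesis
    by (simp add: conv_gr_eq_nn_integral[OF assms(1,2)] nn_integral_optimal_density_neg conj_tau_neg)
next
  case False
  obtain w where w: "0 \<le> w" "tau z w \<noteq> \<infinity>" "\<forall>\<^sub>F v in at w within {0..}. tau z v \<noteq> \<infinity>"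
    "((\<lambda>v. enn2real (tau z v)) has_real_derivative t) (at w within {0..})"
    using assms(3) unfolding tau_deriv_values_def by blast
  note G = optimal_density_integral_at_derivative[OF assms(1,2) w]
  \<comment> \<open>At the mass \<open>w\<close> where \<open>t\<close> is the derivative, the
    single term of the supremum already dominates the integral; this is the reverse of
    \<open>conj_tau_le\<close>.\<close>
  have "enn2ereal (\<integral>\<^sup>+ x. optimal_density z t x \<partial>lborel) \<le> enn2ereal (ennreal (enn2real (tau z w) - t * w))"
    using G(1) by (simp add: less_eq_ennreal.rep_eq)
  also have "\<dots> = ereal (enn2real (tau z w)) - ereal (t * w)" using G(2) by simp
  also have "ereal (enn2real (tau z w)) = enn2ereal (tau z w)"
    using w(2) by (cases "tau z w") auto
  also have "enn2ereal (tau z w) - ereal (t * w) \<le> conj_tau z t"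
    unfolding conj_tau_def by (rule SUP_upper) (use w(1) in simp)
  finally show ?thesis
    using conj_tau_le[OF assms(1), of t] False by (simp add: conv_gr_eq_nn_integral[OF assms(1,2)])
qed

end
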